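(* Let $\mathbb{F}$ be a field, $G$ an abelian group, $X$ a finite poset, and let $I(X)$ be endowed with a $G$-grading, written (up to graded isomorphism) in block triangular form with diagonal blocks $\mathbb{F}H_1,\ldots,\mathbb{F}H_t$ and $G$-graded $(\mathbb{F}H_i,\mathbb{F}H_j)$-bimodules $M_{ij}$ ($i<j$) as described in the context. Fix $i<j$ and let $\mathcal{H}_{ij}=H_i\cap H_j$. Then there exist pairwise distinct characters $\chi^{(ij)}_1,\ldots,\chi^{(ij)}_{s_{ij}}\in\hat{\mathcal{H}}_{ij}$ and homogeneous elements $m_1,\ldots,m_{s_{ij}}\in M_{ij}$ such that $$ M_{ij}=\mathbb{F}H_i\,m_1\,\mathbb{F}H_j\oplus\cdots\oplus\mathbb{F}H_i\,m_{s_{ij}}\,\mathbb{F}H_j, $$ where $hm_\ell=\chi^{(ij)}_\ell(h)\,m_\ell h$ for all $h\in\mathcal{H}_{ij}$ and $\ell=1,\ldots,s_{ij}$. Moreover, as $G$-graded vector spaces, $\mathbb{F}H_i\,m_\ell\,\mathbb{F}H_j\cong(\mathbb{F}(H_iH_j))^{[\deg m_\ell]}$ for each $\ell=1,\ldots,s_{ij}$. Also, $s_{ij}\le|\mathcal{H}_{ij}|$.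
   Context: For a finite poset $(X,\le)$, the incidence algebra is $I(X)=\{f:X\times X\to\mathbb{F}\mid f(x,y)=0 \text{ whenever } x\not\le y\}$ with product $(fg)(x,y)=\sum_{z}f(x,z)g(z,y)$. A $G$-grading on an algebra $A$ is a decomposition $A=\bigoplus_{g\in G}A_g$ with $A_gA_h\subseteq A_{gh}$. Block form: since $G$ is abelian, every $G$-grading on $I(X)$ is, up to graded isomorphism, of the form $$ I(X)\cong\left(\begin{array}{cccc}\mathbb{F}H_1&M_{1,2}&\ldots&M_{1,t}\\&\mathbb{F}H_2&\ddots&\vdots\\&&\ddots&M_{t-1,t}\\&&&\mathbb{F}H_t\end{array}\right), $$ where $H_1,\dots,H_t\subseteq G$ are finite subgroups such that $\operatorname{char}\mathbb{F}\nmid|H_i|$ and $\mathbb{F}$ contains a primitive $\exp(H_i)$-th root of $1$, each $\mathbb{F}H_i$ is graded by $\deg h=h$, and each $M_{i,j}$ is a $G$-graded $(\mathbb{F}H_i,\mathbb{F}H_j)$-bimodule. Concretely, there are pairwise orthogonal homogeneous idempotents $e_1,\dots,e_t$, diagonal in $I(X)$ and with sum $1$, such that $e_iI(X)e_i\cong\mathbb{F}H_i$ as graded algebras, $M_{ij}=e_iI(X)e_j$ for $i<j$, and $e_iI(X)e_j=0$ for $i>j$. $\hat{H}$ denotes the group of homomorphisms $H\to\mathbb{F}^\times$. For a $G$-graded vector space $V=\bigoplus_g V_g$ and $h\in G$ ($G$ abelian), $V^{[h]}$ denotes $V$ with shifted grading $(V^{[h]})_g=V_{h^{-1}g}$. The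 case $M_{ij}=0$ corresponds to $s_{ij}=0$. *)

theory Defs
  imports Complex_Main "HOL-Algebra.Coset" "HOL-Library.Function_Algebras"
begin

text \<open>
  Incidence algebras and group algebras are both realised as sets of scalar-valued functions,
  with pointwise addition. Multiplication is always one of the explicit products
  \<open>inc_mult\<close> and \<open>galg_mult\<close> below, never the pointwise one.
\<close>

definition fscale :: "'f::field \<Rightarrow> ('i \<Rightarrow> 'f) \<Rightarrow> 'i \<Rightarrow> 'f" where
  "fscale c v = (\<lambda>x. c * v x)"

interpretation fun_vs: vector_space "fscale :: 'f::field \<Rightarrow> ('i \<Rightarrow> 'f) \<Rightarrow> 'i \<Rightarrow> 'f"
  by unfold_locales (simp_all add: fscale_def fun_eq_iff algebra_simps)

text \<open>The index set \<open>I\<close> may be infinite, hence the finite support condition.\<close>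

definition is_direct_sum ::
  "('i \<Rightarrow> 'f::field) set \<Rightarrow> 'k set \<Rightarrow> ('k \<Rightarrow> ('i \<Rightarrow> 'f) set) \<Rightarrow> bool" where
  "is_direct_sum W I V \<longleftrightarrow>
     fun_vs.subspace W \<and>
     (\<forall>k\<in>I. fun_vs.subspace (V k) \<and> V k \<subseteq> W) \<and>
     (\<forall>w\<in>W. \<exists>!u. (\<forall>k\<in>I. u k \<in> V k) \<and> (\<forall>k. k \<notin> I \<longrightarrow> u k = 0) \<and>
                   finite {k. u k \<noteq> 0} \<and> w = (\<Sum>k | u k \<noteq> 0. u k))"

definition is_grading ::
  "('g, 'b) monoid_scheme \<Rightarrow> ('i \<Rightarrow> 'f::field) set \<Rightarrow>
   (('i \<Rightarrow> 'f) \<Rightarrow> ('i \<Rightarrow> 'f) \<Rightarrow> ('i \<Rightarrow> 'f)) \<Rightarrow> ('g \<Rightarrow> ('i \<Rightarrow> 'f) set) \<Rightarrow> bool" where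
  "is_grading G A mul Agr \<longleftrightarrow>
     is_direct_sum A (carrier G) Agr \<and>
     (\<forall>g\<in>carrier G. \<forall>h\<in>carrier G. \<forall>a\<in>Agr g. \<forall>b\<in>Agr h. mul a b \<in> Agr (g \<otimes>\<^bsub>G\<^esub> h))"

definition induced_grading ::
  "('g \<Rightarrow> ('i \<Rightarrow> 'f) set) \<Rightarrow> ('i \<Rightarrow> 'f) set \<Rightarrow> 'g \<Rightarrow> ('i \<Rightarrow> 'f) set" where
  "induced_grading Agr V g = V \<inter> Agr g"

definition shift_grading ::
  "('g, 'b) monoid_scheme \<Rightarrow> 'g \<Rightarrow> ('g \<Rightarrow> ('i \<Rightarrow> 'f) set) \<Rightarrow> 'g \<Rightarrow> ('i \<Rightarrow> 'f) set" where
  "shift_grading G h Vgr g = Vgr (inv\<^bsub>G\<^esub> h \<otimes>\<^bsub>G\<^esub> g)"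

text \<open>\<open>\<psi>\<close> is an isomorphism of graded vector spaces; only its values on \<open>V\<close> matter.\<close>

definition graded_space_iso ::
  "('g, 'b) monoid_scheme \<Rightarrow> ('i \<Rightarrow> 'f::field) set \<Rightarrow> ('g \<Rightarrow> ('i \<Rightarrow> 'f) set) \<Rightarrow>
   ('k \<Rightarrow> 'f) set \<Rightarrow> ('g \<Rightarrow> ('k \<Rightarrow> 'f) set) \<Rightarrow> (('i \<Rightarrow> 'f) \<Rightarrow> ('k \<Rightarrow> 'f)) \<Rightarrow> bool" where
  "graded_space_iso G V Vgr W Wgr \<psi> \<longleftrightarrow>
     (\<forall>a\<in>V. \<forall>b\<in>V. \<psi> (a + b) = \<psi> a + \<psi> b) \<and>
     (\<forall>c. \<forall>a\<in>V. \<psi> (fscale c a) = fscale c (\<psi> a)) \<and>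
     bij_betw \<psi> V W \<and>
     (\<forall>g\<in>carrier G. \<psi> ` Vgr g = Wgr g)"

definition graded_algebra_iso ::
  "('g, 'b) monoid_scheme \<Rightarrow>
   ('i \<Rightarrow> 'f::field) set \<Rightarrow> (('i \<Rightarrow> 'f) \<Rightarrow> ('i \<Rightarrow> 'f) \<Rightarrow> ('i \<Rightarrow> 'f)) \<Rightarrow> ('g \<Rightarrow> ('i \<Rightarrow> 'f) set) \<Rightarrow>
   ('k \<Rightarrow> 'f) set \<Rightarrow> (('k \<Rightarrow> 'f) \<Rightarrow> ('k \<Rightarrow> 'f) \<Rightarrow> ('k \<Rightarrow> 'f)) \<Rightarrow> ('g \<Rightarrow> ('k \<Rightarrow> 'f) set) \<Rightarrow>
   (('i \<Rightarrow> 'f) \<Rightarrow> ('k \<Rightarrow> 'f)) \<Rightarrow> bool" where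
  "graded_algebra_iso G A mulA Agr B mulB Bgr \<psi> \<longleftrightarrow>
     graded_space_iso G A Agr B Bgr \<psi> \<and>
     (\<forall>a\<in>A. \<forall>b\<in>A. \<psi> (mulA a b) = mulB (\<psi> a) (\<psi> b))"

definition incidence_algebra :: "'x rel \<Rightarrow> ('x \<times> 'x \<Rightarrow> 'f::field) set" where
  "incidence_algebra r = {f. \<forall>x y. (x, y) \<notin> r \<longrightarrow> f (x, y) = 0}"

definition inc_mult ::
  "'x set \<Rightarrow> ('x \<times> 'x \<Rightarrow> 'f::field) \<Rightarrow> ('x \<times> 'x \<Rightarrow> 'f) \<Rightarrow> 'x \<times> 'x \<Rightarrow> 'f" where
  "inc_mult X f g = (\<lambda>(x, y). \<Sum>z\<in>X. f (x, z) * g (z, y))"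

definition inc_one :: "'x set \<Rightarrow> 'x \<times> 'x \<Rightarrow> 'f::field" where
  "inc_one X = (\<lambda>(x, y). if x \<in> X \<and> x = y then 1 else 0)"

definition peirce ::
  "'x set \<Rightarrow> 'x rel \<Rightarrow> ('x \<times> 'x \<Rightarrow> 'f::field) \<Rightarrow> ('x \<times> 'x \<Rightarrow> 'f) \<Rightarrow> ('x \<times> 'x \<Rightarrow> 'f) set" where
  "peirce X r e f = {inc_mult X (inc_mult X e a) f | a. a \<in> incidence_algebra r}"

text \<open>The group algebra of a subgroup \<open>H\<close>: the formal sum of the \<open>a h \<cdot> h\<close> is the function \<open>a\<close>.\<close>

definition galg :: "'g set \<Rightarrow> ('g \<Rightarrow> 'f::field) set" where
  "galg H = {a. finite {h. a h \<noteq> 0} \<and> {h. a h \<noteq> 0} \<subseteq> H}"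

definition galg_mult ::
  "('g, 'b) monoid_scheme \<Rightarrow> ('g \<Rightarrow> 'f::field) \<Rightarrow> ('g \<Rightarrow> 'f) \<Rightarrow> 'g \<Rightarrow> 'f" where
  "galg_mult G a b =
     (\<lambda>g. if g \<in> carrier G then \<Sum>h | a h \<noteq> 0. a h * b (inv\<^bsub>G\<^esub> h \<otimes>\<^bsub>G\<^esub> g) else 0)"

definition galg_basis :: "'g \<Rightarrow> 'g \<Rightarrow> 'f::field" where
  "galg_basis h = (\<lambda>g. if g = h then 1 else 0)"

definition galg_grading :: "'g set \<Rightarrow> 'g \<Rightarrow> ('g \<Rightarrow> 'f::field) set" where
  "galg_grading H g = {a \<in> galg H. \<forall>h. h \<noteq> g \<longrightarrow> a h = 0}"

definition field_units :: "'f::field monoid" where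
  "field_units = \<lparr>carrier = UNIV - {0}, monoid.mult = (*), one = 1\<rparr>"

text \<open>Characters are extensional, so that distinct elements of the set differ on \<open>H\<close>.\<close>

definition characters :: "('g, 'b) monoid_scheme \<Rightarrow> 'g set \<Rightarrow> ('g \<Rightarrow> 'f::field) set" where
  "characters G H = hom (G\<lparr>carrier := H\<rparr>) field_units \<inter> extensional H"

definition group_exponent :: "('g, 'b) monoid_scheme \<Rightarrow> 'g set \<Rightarrow> nat" where
  "group_exponent G H = (LEAST n. n > 0 \<and> (\<forall>h\<in>H. h [^]\<^bsub>G\<^esub> n = \<one>\<^bsub>G\<^esub>))"

definition primitive_root_of_unity :: "nat \<Rightarrow> 'f::field \<Rightarrow> bool" where
  "primitive_root_of_unity n z \<longleftrightarrow> n > 0 \<and> z ^ n = 1 \<and> (\<forall>k. 0 < k \<and> k < n \<longrightarrow> z ^ k \<noteq> 1)"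

text \<open>
  The data are the subgroups \<open>H i\<close>, the idempotents \<open>e i\<close> and the identifications
  \<open>\<phi> i\<close> of the group algebra of \<open>H i\<close> with the diagonal block of \<open>e i\<close>, for \<open>i = 1, \<dots>, t\<close>.
  The latter also define the bimodule structures: \<open>a\<close> acts from the left on the block
  \<open>(i, j)\<close> as multiplication by \<open>\<phi> i a\<close> and \<open>b\<close> from the right as multiplication by \<open>\<phi> j b\<close>.
\<close>

definition block_triangular_form ::
  "('g, 'b) monoid_scheme \<Rightarrow> 'x set \<Rightarrow> 'x rel \<Rightarrow> ('g \<Rightarrow> ('x \<times> 'x \<Rightarrow> 'f::field) set) \<Rightarrow>
   nat \<Rightarrow> (nat \<Rightarrow> 'g set) \<Rightarrow> (nat \<Rightarrow> 'x \<times> 'x \<Rightarrow> 'f) \<Rightarrow>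
   (nat \<Rightarrow> ('g \<Rightarrow> 'f) \<Rightarrow> 'x \<times> 'x \<Rightarrow> 'f) \<Rightarrow> bool" where
  "block_triangular_form G X r A t H e \<phi> \<longleftrightarrow>
     (\<forall>i\<in>{1..t}. subgroup (H i) G \<and> finite (H i) \<and> \<not> CHAR('f) dvd card (H i) \<and>
        (\<exists>z::'f. primitive_root_of_unity (group_exponent G (H i)) z)) \<and>
     (\<forall>i\<in>{1..t}. e i \<in> incidence_algebra r \<and>
        (\<forall>x y. x \<noteq> y \<longrightarrow> e i (x, y) = 0) \<and>
        (\<exists>g\<in>carrier G. e i \<in> A g) \<and>
        inc_mult X (e i) (e i) = e i) \<and>
     (\<forall>i\<in>{1..t}. \<forall>j\<in>{1..t}. i \<noteq> j \<longrightarrow> inc_mult X (e i) (e j) = 0) \<and>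
     (\<Sum>i\<in>{1..t}. e i) = inc_one X \<and>
     (\<forall>i\<in>{1..t}. graded_algebra_iso G
        (galg (H i)) (galg_mult G) (galg_grading (H i))
        (peirce X r (e i) (e i)) (inc_mult X) (induced_grading A (peirce X r (e i) (e i)))
        (\<phi> i)) \<and>
     (\<forall>i\<in>{1..t}. \<forall>j\<in>{1..t}. j < i \<longrightarrow> peirce X r (e i) (e j) = {0})"

text \<open>
  The sub-bimodule \<open>FP m FQ\<close> generated by \<open>m\<close>, where the group algebras of \<open>P\<close> and \<open>Q\<close>
  act through \<open>\<alpha>\<close> and \<open>\<beta>\<close>.
\<close>

definition cyclic_bimodule ::
  "'x set \<Rightarrow> 'g set \<Rightarrow> (('g \<Rightarrow> 'f::field) \<Rightarrow> 'x \<times> 'x \<Rightarrow> 'f) \<Rightarrow> ('x \<times> 'x \<Rightarrow> 'f) \<Rightarrow>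
   'g set \<Rightarrow> (('g \<Rightarrow> 'f) \<Rightarrow> 'x \<times> 'x \<Rightarrow> 'f) \<Rightarrow> ('x \<times> 'x \<Rightarrow> 'f) set" where
  "cyclic_bimodule X P \<alpha> m Q \<beta> =
     fun_vs.span {inc_mult X (inc_mult X (\<alpha> a) m) (\<beta> b) | a b. a \<in> galg P \<and> b \<in> galg Q}"

end

theory Submission
  imports Defs
begin

text \<open>
  The diagonal block of \<open>e\<^sub>i\<close> is commutative, so the support of \<open>e\<^sub>i\<close> is an antichain and the
  block consists of diagonal matrices. Hence a group element \<open>h \<in> H\<^sub>i\<close> acts on row \<open>x\<close> by a scalar
  \<open>\<lambda>\<^sub>x(h)\<close>, likewise \<open>k \<in> H\<^sub>j\<close> acts on column \<open>y\<close> by \<open>\<mu>\<^sub>y(k)\<close>, and \<open>M\<^sub>i\<^sub>j\<close> is the direct sum of its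
  isotypic components, spanned by the matrix units at the \<open>(x, y)\<close> for which \<open>\<lambda>\<^sub>x/\<mu>\<^sub>y\<close> restricts to
  a given character \<open>\<chi>\<close> of \<open>H\<^sub>i \<inter> H\<^sub>j\<close>. These components are graded, and a nonzero homogeneous
  element \<open>m\<close> of one of them vanishes at none of its positions \<open>(x, y)\<close>. As the diagonal blocks
  contain the diagonal matrix units, \<open>m\<close> generates the whole component. Moreover \<open>hmk\<close> depends only
  on \<open>hk\<close> up to a nonzero scalar, so the component has a basis indexed by \<open>H\<^sub>iH\<^sub>j\<close>.
\<close>

section \<open>Pointwise calculus of functions and matrix units\<close>

lemma sum_apply: "(\<Sum>k\<in>S. f k) x = (\<Sum>k\<in>S. f k x)"
  by (induction S rule: infinite_finite_induct) auto

lemma fscale_apply [simp]: "fscale c f x = c * f x"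
  by (simp add: fscale_def)

definition mat_unit :: "'x \<Rightarrow> 'x \<Rightarrow> 'x \<times> 'x \<Rightarrow> 'f::field" where
  "mat_unit x y = (\<lambda>p. if p = (x, y) then 1 else 0)"

lemma mat_unit_neq_0 [simp]: "mat_unit x y \<noteq> (0 :: 'x \<times> 'x \<Rightarrow> 'f::field)"
proof
  assume "mat_unit x y = (0 :: 'x \<times> 'x \<Rightarrow> 'f)"
  then have "mat_unit x y (x, y) = (0 :: 'f)" by simp
  then show False by (simp add: mat_unit_def)
qed

lemma function_as_sum_mat_unit:
  assumes "finite S" "\<And>p. f p \<noteq> 0 \<Longrightarrow> p \<in> S"
  shows "f = (\<Sum>p\<in>S. fscale (f p) (mat_unit (fst p) (snd p)))"
proof
  fix q
  have "(\<Sum>p\<in>S. fscale (f p) (mat_unit (fst p) (snd p))) q = (\<Sum>p\<in>S. if q = p then f p else 0)"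
    unfolding sum_apply by (rule sum.cong) (auto simp: mat_unit_def)
  also have "\<dots> = f q" using assms(1) assms(2)[of q] by (cases "q \<in> S") auto
  finally show "f q = (\<Sum>p\<in>S. fscale (f p) (mat_unit (fst p) (snd p))) q" ..
qed

subsection \<open>Incidence products\<close>

lemma inc_mult_fscale_left: "inc_mult X (fscale k a) c = fscale k (inc_mult X a c)"
  by (auto simp: inc_mult_def fun_eq_iff sum_distrib_left algebra_simps)

lemma inc_mult_fscale_right: "inc_mult X c (fscale k a) = fscale k (inc_mult X c a)"
  by (auto simp: inc_mult_def fun_eq_iff sum_distrib_left algebra_simps)

lemma inc_mult_sum_left: "inc_mult X (\<Sum>k\<in>S. f k) c = (\<Sum>k\<in>S. inc_mult X (f k) c)"
proof
  fix p :: "'a \<times> 'a"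
  obtain x y where p: "p = (x, y)" by fastforce
  show "inc_mult X (\<Sum>k\<in>S. f k) c p = (\<Sum>k\<in>S. inc_mult X (f k) c) p"
    unfolding p sum_apply inc_mult_def prod.case sum_distrib_right by (rule sum.swap)
qed

lemma inc_mult_sum_right: "inc_mult X c (\<Sum>k\<in>S. f k) = (\<Sum>k\<in>S. inc_mult X c (f k))"
proof
  fix p :: "'a \<times> 'a"
  obtain x y where p: "p = (x, y)" by fastforce
  show "inc_mult X c (\<Sum>k\<in>S. f k) p = (\<Sum>k\<in>S. inc_mult X c (f k)) p"
    unfolding p sum_apply inc_mult_def prod.case sum_distrib_left by (rule sum.swap)
qed

text \<open>The sum in \<open>inc_mult\<close> runs over \<open>X\<close> while the functions live
  on the whole type, hence the value 0 for a row index outside \<open>X\<close>.\<close>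

lemma inc_mult_diagonal_left:
  assumes "finite X" "\<And>x y. x \<noteq> y \<Longrightarrow> a (x, y) = 0"
  shows "inc_mult X a v (x, y) = (if x \<in> X then a (x, x) * v (x, y) else 0)"
proof -
  have "inc_mult X a v (x, y) = (\<Sum>w\<in>X. if x = w then a (x, x) * v (x, y) else 0)"
    unfolding inc_mult_def prod.case by (intro sum.cong refl) (simp add: assms)
  then show ?thesis using \<open>finite X\<close> by simp
qed

lemma inc_mult_diagonal_right:
  assumes "finite X" "\<And>x y. x \<noteq> y \<Longrightarrow> b (x, y) = 0"
  shows "inc_mult X v b (x, y) = (if y \<in> X then v (x, y) * b (y, y) else 0)"
proof -
  have "inc_mult X v b (x, y) = (\<Sum>w\<in>X. if y = w then v (x, y) * b (y, y) else 0)"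
    unfolding inc_mult_def prod.case by (intro sum.cong refl) (simp add: assms)
  then show ?thesis using \<open>finite X\<close> by simp
qed

subsection \<open>Direct sums and homogeneous components\<close>

text \<open>Uniqueness of the decomposition of 0: the family \<open>u\<close>, extended by 0 outside
  \<open>S\<close>, and the zero family both decompose it.\<close>

lemma is_direct_sum_sum_eq_0:
  assumes ds: "is_direct_sum W I V" and "finite S" "S \<subseteq> I"
    and u: "\<And>k. k \<in> S \<Longrightarrow> u k \<in> V k" and zero: "(\<Sum>k\<in>S. u k) = 0" and "k \<in> S"
  shows "u k = 0"
proof -
  let ?Q = "\<lambda>w u. (\<forall>k\<in>I. u k \<in> V k) \<and> (\<forall>k. k \<notin> I \<longrightarrow> u k = 0) \<and>
                   finite {k. u k \<noteq> 0} \<and> w = (\<Sum>k | u k \<noteq> 0. u k)"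
  have sub: "fun_vs.subspace W" "\<And>k. k \<in> I \<Longrightarrow> fun_vs.subspace (V k)"
    using ds by (auto simp: is_direct_sum_def)
  then have "0 \<in> W" by (rule_tac fun_vs.subspace_0)
  then have "\<exists>!u. ?Q 0 u" using ds unfolding is_direct_sum_def by blast
  then obtain u0 where u0: "\<And>u. ?Q 0 u \<Longrightarrow> u = u0" by (elim ex1E) iprover
  have "(\<lambda>_. 0) = u0"
    using sub fun_vs.subspace_0 by (intro u0) auto
  moreover have "(\<lambda>k. if k \<in> S then u k else 0) = u0"
  proof (intro u0 conjI ballI allI impI)
    show "(if l \<in> S then u l else 0) \<in> V l" if "l \<in> I" for l
      using that u sub fun_vs.subspace_0 by auto
    have "(\<Sum>k | (if k \<in> S then u k else 0) \<noteq> 0. if k \<in> S then u k else 0) = (\<Sum>k\<in>S. u k)"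
      by (rule sum.mono_neutral_cong_left) (use \<open>finite S\<close> in auto)
    then show "0 = (\<Sum>k | (if k \<in> S then u k else 0) \<noteq> 0. if k \<in> S then u k else 0)"
      using zero by simp
    show "finite {k. (if k \<in> S then u k else 0) \<noteq> 0}"
      by (rule finite_subset[OF _ \<open>finite S\<close>]) auto
  qed (use \<open>S \<subseteq> I\<close> in auto)
  ultimately have "(\<lambda>k. if k \<in> S then u k else 0) = (\<lambda>_. 0)" by (rule trans[OF _ sym, rotated])
  from fun_cong[OF this, of k] show ?thesis using \<open>k \<in> S\<close> by simp
qed

text \<open>Grouping the terms by degree leaves one summand per degree, and these vanish separately.
  This is the tool for comparing degrees below; several \<open>t\<close> may share a degree.\<close>

lemma is_direct_sum_homogeneous_part_eq_0:
  assumes ds: "is_direct_sum W I V" and "finite T"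
    and deg: "\<And>t. t \<in> T \<Longrightarrow> d t \<in> I \<and> v t \<in> V (d t)"
    and zero: "(\<Sum>t\<in>T. v t) = 0" and "k \<in> I"
  shows "(\<Sum>t | t \<in> T \<and> d t = k. v t) = 0"
proof (cases "k \<in> d ` T")
  case True
  have "(\<Sum>l\<in>d ` T. \<Sum>t | t \<in> T \<and> d t = l. v t) = 0"
    using zero sum.group[of T "d ` T" d v] \<open>finite T\<close> by simp
  moreover have "(\<Sum>t | t \<in> T \<and> d t = l. v t) \<in> V l" if "l \<in> d ` T" for l
  proof (rule fun_vs.subspace_sum)
    show "fun_vs.subspace (V l)" using that deg ds by (auto simp: is_direct_sum_def)
  qed (use deg in auto)
  ultimately show ?thesis
    using is_direct_sum_sum_eq_0[OF ds, of "d ` T" "\<lambda>l. \<Sum>t | t \<in> T \<and> d t = l. v t"]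
      \<open>finite T\<close> deg True by blast
next
  case False
  then have "{t. t \<in> T \<and> d t = k} = {}" by auto
  then show ?thesis by (simp only: sum.empty)
qed

lemma is_direct_sum_decompose:
  assumes "is_direct_sum W I V" "w \<in> W"
  obtains S u where "finite S" "S \<subseteq> I" "\<And>k. k \<in> S \<Longrightarrow> u k \<in> V k" "w = (\<Sum>k\<in>S. u k)"
proof -
  obtain u where u: "\<forall>k\<in>I. u k \<in> V k" "\<forall>k. k \<notin> I \<longrightarrow> u k = 0"
      "finite {k. u k \<noteq> 0}" "w = (\<Sum>k | u k \<noteq> 0. u k)"
    using assms unfolding is_direct_sum_def by blast
  then show ?thesis by (intro that[of "{k. u k \<noteq> 0}" u]) auto
qed

subsection \<open>Group algebras and characters\<close>

lemma subspace_galg: "fun_vs.subspace (galg H :: ('g \<Rightarrow> 'f::field) set)"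
proof (rule fun_vs.subspaceI)
  show "0 \<in> galg H" by (auto simp: galg_def)
  show "x + y \<in> galg H" if "x \<in> galg H" "y \<in> galg H" for x y :: "'g \<Rightarrow> 'f"
    using that finite_subset[of "{h. x h + y h \<noteq> 0}" "{h. x h \<noteq> 0} \<union> {h. y h \<noteq> 0}"]
    by (force simp: galg_def)
  show "fscale c x \<in> galg H" if "x \<in> galg H" for c and x :: "'g \<Rightarrow> 'f"
    using that finite_subset[of "{h. fscale c x h \<noteq> 0}" "{h. x h \<noteq> 0}"]
    by (force simp: galg_def)
qed

lemma galg_basis_in_galg: "h \<in> H \<Longrightarrow> galg_basis h \<in> galg H"
  by (auto simp: galg_def galg_basis_def)

lemma galg_basis_in_grading: "h \<in> H \<Longrightarrow> galg_basis h \<in> galg_grading H h"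
  by (auto simp: galg_grading_def galg_basis_in_galg) (simp add: galg_basis_def)

lemma galg_finite: "finite H \<Longrightarrow> galg H = {a. \<forall>h. h \<notin> H \<longrightarrow> a h = 0}"
  by (auto simp: galg_def intro: rev_finite_subset[of H])

lemma galg_sum_basis:
  assumes "finite H" "a \<in> galg H"
  shows "a = (\<Sum>h\<in>H. fscale (a h) (galg_basis h))"
proof
  fix g
  have "(\<Sum>h\<in>H. fscale (a h) (galg_basis h)) g = (\<Sum>h\<in>H. if g = h then a h else 0)"
    unfolding sum_apply by (rule sum.cong) (auto simp: galg_basis_def)
  then show "a g = (\<Sum>h\<in>H. fscale (a h) (galg_basis h)) g"
    using assms by (auto simp: galg_finite)
qed

lemma (in group) galg_mult_basis:
  assumes "h \<in> carrier G"
  shows "galg_mult G (galg_basis h) b g = (if g \<in> carrier G then b (inv h \<otimes> g) else 0)"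
proof -
  have "{k. galg_basis h k \<noteq> (0::'c)} = {h}" by (auto simp: galg_basis_def)
  then show ?thesis unfolding galg_mult_def by (simp add: galg_basis_def)
qed

lemma (in group) galg_mult_basis_basis:
  assumes "h \<in> carrier G" "k \<in> carrier G"
  shows "galg_mult G (galg_basis h) (galg_basis k) = galg_basis (h \<otimes> k)"
proof
  fix g
  show "galg_mult G (galg_basis h) (galg_basis k) g = galg_basis (h \<otimes> k) g"
    unfolding galg_mult_basis[OF assms(1)]
    using assms by (auto simp: galg_basis_def inv_solve_left')
qed

lemma (in group) sum_translate:
  assumes "subgroup L G" "k \<in> L"
  shows "(\<Sum>h\<in>L. f (k \<otimes> h)) = (\<Sum>h\<in>L. f h)"
proof (rule sum.reindex_bij_witness)
  interpret L: subgroup L G by fact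
  show "inv k \<otimes> (k \<otimes> h) = h" "k \<otimes> (inv k \<otimes> h) = h" "inv k \<otimes> h \<in> L" "k \<otimes> h \<in> L"
    if "h \<in> L" for h
    using that \<open>k \<in> L\<close> by (simp_all add: m_assoc[symmetric])
qed simp

text \<open>Translation by \<open>k\<close> permutes \<open>L\<close>. If the scalar
  \<open>f k\<close> differs from 1, the sum must therefore be 0.\<close>

lemma (in group) sum_multiplicative_scale:
  fixes f :: "'a \<Rightarrow> 'f::field"
  assumes "subgroup L G" "k \<in> L" "\<And>h. h \<in> L \<Longrightarrow> f (k \<otimes> h) = f k * f h"
  shows "f k * (\<Sum>h\<in>L. f h) = (\<Sum>h\<in>L. f h)"
  using sum_translate[OF assms(1,2), of f] assms(3) by (simp add: sum_distrib_left)

section \<open>Characters: orthogonality and the bound on their number\<close>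

lemma characters_mult:
  "\<chi> \<in> characters G L \<Longrightarrow> h \<in> L \<Longrightarrow> k \<in> L \<Longrightarrow> \<chi> (h \<otimes>\<^bsub>G\<^esub> k) = \<chi> h * \<chi> k"
  by (auto simp: characters_def field_units_def hom_def)

lemma characters_nonzero: "\<chi> \<in> characters G L \<Longrightarrow> h \<in> L \<Longrightarrow> \<chi> h \<noteq> 0"
  by (auto simp: characters_def field_units_def hom_def)

lemma characters_ext:
  "\<chi> \<in> characters G L \<Longrightarrow> \<chi>' \<in> characters G L \<Longrightarrow> (\<And>h. h \<in> L \<Longrightarrow> \<chi> h = \<chi>' h) \<Longrightarrow> \<chi> = \<chi>'"
  by (auto simp: characters_def intro: extensionalityI)

text \<open>Distinct characters differ at some \<open>k\<close>, and translating by \<open>k\<close>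
  multiplies the sum by the scalar \<open>\<chi> k / \<chi>' k\<close>, which is not 1.\<close>

lemma (in group) characters_orthogonal:
  assumes L: "subgroup L G" and \<chi>: "\<chi> \<in> characters G L" and \<chi>': "\<chi>' \<in> characters G L"
  shows "(\<Sum>h\<in>L. \<chi> h / \<chi>' h) = (if \<chi> = \<chi>' then of_nat (card L) else (0 :: 'f::field))"
proof (cases "\<chi> = \<chi>'")
  case True
  then show ?thesis using characters_nonzero[OF \<chi>'] by simp
next
  case False
  then obtain k where k: "k \<in> L" "\<chi> k \<noteq> \<chi>' k" using characters_ext \<chi> \<chi>' by metis
  have "\<chi> k / \<chi>' k * (\<Sum>h\<in>L. \<chi> h / \<chi>' h) = (\<Sum>h\<in>L. \<chi> h / \<chi>' h)"
    using k by (intro sum_multiplicative_scale L) (simp_all add: characters_mult[OF \<chi>] characters_mult[OF \<chi>'])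
  moreover have "\<chi> k / \<chi>' k \<noteq> 1" using k characters_nonzero[OF \<chi>'] by simp
  ultimately have "(\<Sum>h\<in>L. \<chi> h / \<chi>' h) = 0" by (blast dest: mult_cancel_right2[THEN iffD1])
  then show ?thesis using False by simp
qed

text \<open>Orthogonality makes the characters linearly independent inside the group algebra, which
  is spanned by \<open>card L\<close> elements.\<close>

lemma (in group) card_characters_le:
  fixes C :: "('a \<Rightarrow> 'f::field) set"
  assumes L: "subgroup L G" "finite L" "of_nat (card L) \<noteq> (0 :: 'f)"
    and C: "C \<subseteq> characters G L" "finite C"
  shows "card C \<le> card L"
proof -
  \<comment> \<open>Characters are extensional, so outside \<open>L\<close> they take the value
    \<open>undefined\<close>; replacing it by 0 puts them into \<open>galg L\<close>.\<close>
  define T where "T \<chi> h = (if h \<in> L then \<chi> h else 0)" for \<chi> :: "'a \<Rightarrow> 'f" and h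
  have inj: "inj_on T C"
  proof (rule inj_onI)
    fix \<chi> \<chi>' assume "\<chi> \<in> C" "\<chi>' \<in> C" "T \<chi> = T \<chi>'"
    then show "\<chi> = \<chi>'"
      using characters_ext[of \<chi> G L \<chi>'] C by (auto simp: T_def fun_eq_iff) (metis subsetD)
  qed
  have "fun_vs.independent (T ` C)"
  proof (rule fun_vs.independent_if_scalars_zero)
    fix a and v assume zero: "(\<Sum>v\<in>T ` C. fscale (a v) v) = 0" and "v \<in> T ` C"
    then obtain \<chi>' where \<chi>': "\<chi>' \<in> C" "v = T \<chi>'" by auto
    have "(\<Sum>\<chi>\<in>C. fscale (a (T \<chi>)) (T \<chi>)) = 0"
      using zero inj by (simp add: sum.reindex)
    then have pt: "(\<Sum>\<chi>\<in>C. a (T \<chi>) * T \<chi> h) = 0" for h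
      by (simp add: fun_eq_iff sum_apply)
    \<comment> \<open>Dividing the relation by \<open>\<chi>'\<close> and summing over
      \<open>L\<close> kills every term except that of \<open>\<chi>'\<close>; its factor
      \<open>card L\<close> is nonzero in the field.\<close>
    have "0 = (\<Sum>h\<in>L. (\<Sum>\<chi>\<in>C. a (T \<chi>) * T \<chi> h) / \<chi>' h)" by (simp only: pt) simp
    also have "\<dots> = (\<Sum>h\<in>L. \<Sum>\<chi>\<in>C. a (T \<chi>) * (\<chi> h / \<chi>' h))"
      by (intro sum.cong) (simp_all add: T_def sum_divide_distrib)
    also have "\<dots> = (\<Sum>\<chi>\<in>C. \<Sum>h\<in>L. a (T \<chi>) * (\<chi> h / \<chi>' h))" by (rule sum.swap)
    also have "\<dots> = (\<Sum>\<chi>\<in>C. a (T \<chi>) * (\<Sum>h\<in>L. \<chi> h / \<chi>' h))" by (simp only: sum_distrib_left)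
    also have "\<dots> = (\<Sum>\<chi>\<in>C. if \<chi> = \<chi>' then a (T \<chi>') * of_nat (card L) else 0)"
      using C \<chi>' by (intro sum.cong) (auto simp: characters_orthogonal[OF L(1)] subset_iff)
    also have "\<dots> = a v * of_nat (card L)" using \<chi>' C by simp
    finally show "a v = 0" using L by simp
  qed (use C in simp)
  moreover have "T ` C \<subseteq> fun_vs.span (galg_basis ` L)"
  proof safe
    fix \<chi>
    have "T \<chi> \<in> galg L" using L by (auto simp: galg_finite T_def)
    then have "T \<chi> = (\<Sum>h\<in>L. fscale (T \<chi> h) (galg_basis h))" by (rule galg_sum_basis[OF L(2)])
    moreover have "\<dots> \<in> fun_vs.span (galg_basis ` L)"
      by (intro fun_vs.span_sum fun_vs.span_scale fun_vs.span_base) auto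
    ultimately show "T \<chi> \<in> fun_vs.span (galg_basis ` L)" by simp
  qed
  ultimately have "card (T ` C) \<le> card (galg_basis ` L :: ('a \<Rightarrow> 'f) set)"
    using fun_vs.independent_span_bound[of "galg_basis ` L"] L by blast
  also have "\<dots> \<le> card L" using L by (intro card_image_le)
  finally show ?thesis using inj by (simp add: card_image)
qed

text \<open>The vectors \<open>b g\<close> are nonzero with pairwise distinct degrees
  \<open>d \<otimes> g\<close>, so they form a basis of \<open>B\<close>. The isomorphism is the
  inverse of the linear map \<open>\<theta>\<close> sending the group element \<open>g\<close> to
  \<open>b g\<close>; since \<open>\<theta>\<close> multiplies degrees by \<open>d\<close>, the
  shift by \<open>d\<close> appears.\<close>

lemma (in group) graded_space_iso_homogeneous_basis:
  fixes A :: "'a \<Rightarrow> ('i \<Rightarrow> 'f::field) set"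
  assumes ds: "is_direct_sum W (carrier G) A"
    and K: "finite K" "K \<subseteq> carrier G" and d: "d \<in> carrier G"
    and b: "\<And>g. g \<in> K \<Longrightarrow> b g \<in> A (d \<otimes> g) \<and> b g \<noteq> 0"
    and B: "B = fun_vs.span (b ` K)"
  shows "\<exists>\<psi>. graded_space_iso G B (induced_grading A B)
           (galg K) (shift_grading G d (galg_grading K)) \<psi>"
proof -
  define \<theta> where "\<theta> a = (\<Sum>g\<in>K. fscale (a g) (b g))" for a
  have subA: "fun_vs.subspace (A g)" if "g \<in> carrier G" for g
    using ds that by (auto simp: is_direct_sum_def)
  have add: "\<theta> (a + a') = \<theta> a + \<theta> a'" for a a'
    by (simp add: \<theta>_def fun_vs.scale_left_distrib sum.distrib)
  have scale: "\<theta> (fscale c a) = fscale c (\<theta> a)" for c a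
    by (simp add: \<theta>_def fun_vs.scale_sum_right)
  have deg: "d \<otimes> g \<in> carrier G \<and> fscale (a g) (b g) \<in> A (d \<otimes> g)" if "g \<in> K" for a g
    using that b K d subA fun_vs.subspace_scale by (meson m_closed subsetD)
  have zero: "a = 0" if a: "a \<in> galg K" "\<theta> a = 0" for a
  proof
    fix g
    show "a g = 0 g"
    proof (cases "g \<in> K")
      case True
      have "(\<Sum>t | t \<in> K \<and> d \<otimes> t = d \<otimes> g. fscale (a t) (b t)) = 0"
        using a(2) True K d
        by (intro is_direct_sum_homogeneous_part_eq_0[OF ds] deg) (auto simp: \<theta>_def)
      \<comment> \<open>Cancelling \<open>d\<close> shows that each degree is attained by a single
        basis vector.\<close>
      moreover have "{t. t \<in> K \<and> d \<otimes> t = d \<otimes> g} = {g}"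
        using K d True by (auto simp: subset_iff)
      ultimately have "fscale (a g) (b g) = 0" by simp
      then show ?thesis using b[OF True] by simp
    next
      case False
      then show ?thesis using a K by (simp add: galg_finite)
    qed
  qed
  have inj: "inj_on \<theta> (galg K)"
  proof (rule inj_onI)
    fix a a' assume a: "a \<in> galg K" "a' \<in> galg K" "\<theta> a = \<theta> a'"
    have "\<theta> (a - a') = \<theta> a - \<theta> a'"
      by (simp add: \<theta>_def fun_vs.scale_left_diff_distrib sum_subtractf)
    then have "a - a' = 0"
      using a fun_vs.subspace_diff[OF subspace_galg] by (intro zero) simp_all
    then show "a = a'" by simp
  qed
  have basis: "\<theta> (galg_basis g) = b g" if "g \<in> K" for g
  proof -
    have "\<theta> (galg_basis g) = (\<Sum>k\<in>K. if k = g then b g else 0)"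
      unfolding \<theta>_def by (rule sum.cong) (auto simp: galg_basis_def)
    then show ?thesis using K that by simp
  qed
  have image: "\<theta> ` galg K = B"
  proof
    show "\<theta> ` galg K \<subseteq> B"
      unfolding \<theta>_def B
      by (auto intro!: fun_vs.span_sum fun_vs.span_scale intro: fun_vs.span_base)
    have "fun_vs.subspace (\<theta> ` galg K)"
    proof (rule fun_vs.subspaceI)
      have "\<theta> 0 = 0" by (simp add: \<theta>_def)
      then show "0 \<in> \<theta> ` galg K"
        using imageI[OF fun_vs.subspace_0[OF subspace_galg], of \<theta> K] by (simp only:)
    next
      fix x y assume "x \<in> \<theta> ` galg K" "y \<in> \<theta> ` galg K"
      then obtain a a' where "a \<in> galg K" "a' \<in> galg K" and xy: "x = \<theta> a" "y = \<theta> a'" by auto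
      then have "a + a' \<in> galg K" by (intro fun_vs.subspace_add[OF subspace_galg])
      then show "x + y \<in> \<theta> ` galg K" unfolding xy add[symmetric] by (rule imageI)
    next
      fix c x assume "x \<in> \<theta> ` galg K"
      then obtain a where "a \<in> galg K" and x: "x = \<theta> a" by auto
      then have "fscale c a \<in> galg K" by (intro fun_vs.subspace_scale[OF subspace_galg])
      then show "fscale c x \<in> \<theta> ` galg K" unfolding x scale[symmetric] by (rule imageI)
    qed
    then show "B \<subseteq> \<theta> ` galg K"
      unfolding B using imageI[OF galg_basis_in_galg, of _ K \<theta>]
      by (intro fun_vs.span_minimal image_subsetI) (simp_all only: basis)
  qed
  have graded: "\<theta> a \<in> A g \<longleftrightarrow> a \<in> galg_grading K (inv d \<otimes> g)"
    if a: "a \<in> galg K" and g: "g \<in> carrier G" for a g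
  proof
    assume "a \<in> galg_grading K (inv d \<otimes> g)"
    then have a0: "a h = 0" if "h \<noteq> inv d \<otimes> g" for h using that by (auto simp: galg_grading_def)
    show "\<theta> a \<in> A g"
      unfolding \<theta>_def
    proof (rule fun_vs.subspace_sum[OF subA[OF g]])
      fix h assume h: "h \<in> K"
      show "fscale (a h) (b h) \<in> A g"
      proof (cases "h = inv d \<otimes> g")
        case True
        then have "d \<otimes> h = g" using d g by (simp add: m_assoc[symmetric])
        then show ?thesis using deg[OF h] by auto
      next
        case False
        then show ?thesis using a0 fun_vs.subspace_0[OF subA[OF g]] by simp
      qed
    qed
  next
    assume \<theta>: "\<theta> a \<in> A g"
    have "a h = 0" if h: "h \<noteq> inv d \<otimes> g" for h
    proof (cases "h \<in> K")
      case True
      \<comment> \<open>The definition of \<open>\<theta> a\<close> becomes a vanishing sum of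
        homogeneous terms: \<open>None\<close> carries the term \<open>- \<theta> a\<close> of
        degree \<open>g\<close>, and \<open>Some t\<close> the multiple of \<open>b t\<close>. In
        degree \<open>d \<otimes> h\<close>, different from \<open>g\<close>, only the term of
        \<open>h\<close> remains.\<close>
      define v where "v t = (case t of None \<Rightarrow> - \<theta> a | Some t \<Rightarrow> fscale (a t) (b t))" for t
      define e where "e t = (case t of None \<Rightarrow> g | Some t \<Rightarrow> d \<otimes> t)" for t
      have "(\<Sum>t\<in>insert None (Some ` K). v t) = v None + (\<Sum>t\<in>K. v (Some t))"
        using K by (simp add: sum.reindex)
      then have "(\<Sum>t\<in>insert None (Some ` K). v t) = 0" by (simp add: v_def \<theta>_def)
      moreover have "e t \<in> carrier G \<and> v t \<in> A (e t)" if "t \<in> insert None (Some ` K)" for t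
        using that deg g fun_vs.subspace_neg[OF subA[OF g] \<theta>] by (auto simp: e_def v_def)
      ultimately have "(\<Sum>t | t \<in> insert None (Some ` K) \<and> e t = d \<otimes> h. v t) = 0"
        using K d True by (intro is_direct_sum_homogeneous_part_eq_0[OF ds]) auto
      moreover have "g \<noteq> d \<otimes> h"
        using h d K True by (auto simp: m_assoc[symmetric] subset_iff)
      then have "{t. t \<in> insert None (Some ` K) \<and> e t = d \<otimes> h} = {Some h}"
        using K d True by (auto simp: e_def subset_iff)
      ultimately have "fscale (a h) (b h) = 0" by (simp add: v_def)
      then show ?thesis using b[OF True] by simp
    next
      case False
      then show ?thesis using a K by (simp add: galg_finite)
    qed
    then show "a \<in> galg_grading K (inv d \<otimes> g)" using a by (auto simp: galg_grading_def)
  qed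
  define \<psi> where "\<psi> = the_inv_into (galg K) \<theta>"
  have \<psi>: "\<psi> (\<theta> a) = a" if "a \<in> galg K" for a
    unfolding \<psi>_def using inj that by (rule the_inv_into_f_f)
  have "graded_space_iso G B (induced_grading A B) (galg K) (shift_grading G d (galg_grading K)) \<psi>"
    unfolding graded_space_iso_def
  proof (intro conjI ballI allI)
    fix x y assume "x \<in> B" "y \<in> B"
    then obtain a a' where a: "a \<in> galg K" "a' \<in> galg K" "x = \<theta> a" "y = \<theta> a'"
      unfolding image[symmetric] by auto
    then have "a + a' \<in> galg K" by (intro fun_vs.subspace_add[OF subspace_galg])
    with a show "\<psi> (x + y) = \<psi> x + \<psi> y" by (simp only: \<psi> flip: add)
  next
    fix c x assume "x \<in> B"
    then obtain a where a: "a \<in> galg K" "x = \<theta> a" unfolding image[symmetric] by auto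
    then have "fscale c a \<in> galg K" by (intro fun_vs.subspace_scale[OF subspace_galg])
    with a show "\<psi> (fscale c x) = fscale c (\<psi> x)" by (simp only: \<psi> flip: scale)
  next
    show "bij_betw \<psi> B (galg K)"
      unfolding \<psi>_def using inj image by (intro bij_betw_the_inv_into) (simp add: bij_betw_def)
  next
    fix g assume g: "g \<in> carrier G"
    have "induced_grading A B g = \<theta> ` galg_grading K (inv d \<otimes> g)"
      unfolding induced_grading_def image[symmetric] using graded[OF _ g]
      by (auto simp: galg_grading_def)
    then have "\<psi> ` induced_grading A B g = (\<lambda>a. \<psi> (\<theta> a)) ` galg_grading K (inv d \<otimes> g)"
      by (simp add: image_image)
    also have "\<dots> = galg_grading K (inv d \<otimes> g)"
      using \<psi> by (auto simp: galg_grading_def image_iff)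
    finally show "\<psi> ` induced_grading A B g = shift_grading G d (galg_grading K) g"
      by (simp add: shift_grading_def)
  qed
  then show ?thesis by blast
qed

subsection \<open>Diagonal blocks\<close>

definition diag_support :: "('x \<times> 'x \<Rightarrow> 'f::field) \<Rightarrow> 'x set" where
  "diag_support e = {x. e (x, x) \<noteq> 0}"

text \<open>The image of a group element will turn out to be a diagonal matrix, so this entry is its
  eigenvalue at \<open>x\<close>. On the support of the idempotent it is multiplicative in
  \<open>h\<close>.\<close>

definition weight :: "(('g \<Rightarrow> 'f::field) \<Rightarrow> 'x \<times> 'x \<Rightarrow> 'f) \<Rightarrow> 'x \<Rightarrow> 'g \<Rightarrow> 'f" where
  "weight \<phi> x h = \<phi> (galg_basis h) (x, x)"

section \<open>The graded incidence algebra and its Peirce blocks\<close>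

locale graded_incidence_algebra = comm_group G for G (structure) +
  fixes X :: "'x set" and r :: "'x rel" and A :: "'a \<Rightarrow> ('x \<times> 'x \<Rightarrow> 'f::field) set"
  assumes finite_X: "finite X"
    and order: "partial_order_on X r"
    and grading: "is_grading G (incidence_algebra r) (inc_mult X) A"
begin

lemma r_in_X: "(x, y) \<in> r \<Longrightarrow> x \<in> X \<and> y \<in> X"
  using order by (auto simp: partial_order_on_def preorder_on_def)

lemma r_refl: "x \<in> X \<Longrightarrow> (x, x) \<in> r"
  using order by (auto simp: partial_order_on_def preorder_on_def refl_on_def)

lemma direct_sum: "is_direct_sum (incidence_algebra r) (carrier G) A"
  using grading by (simp add: is_grading_def)

lemma subspace_homogeneous: "g \<in> carrier G \<Longrightarrow> fun_vs.subspace (A g)"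
  and homogeneous_subset: "g \<in> carrier G \<Longrightarrow> A g \<subseteq> incidence_algebra r"
  using direct_sum by (auto simp: is_direct_sum_def)

lemma homogeneous_mult:
  "\<lbrakk>g \<in> carrier G; h \<in> carrier G; a \<in> A g; b \<in> A h\<rbrakk> \<Longrightarrow> inc_mult X a b \<in> A (g \<otimes> h)"
  using grading by (simp add: is_grading_def)

lemma inc_mult_diagonal:
  assumes "\<And>x y. x \<noteq> y \<Longrightarrow> a (x, y) = 0" "\<And>x y. x \<noteq> y \<Longrightarrow> b (x, y) = 0"
    and "v \<in> incidence_algebra r"
  shows "inc_mult X (inc_mult X a v) b (x, y) = a (x, x) * v (x, y) * b (y, y)"
proof -
  have "v (x, y) = 0" if "x \<notin> X \<or> y \<notin> X"
    using assms(3) r_in_X that by (auto simp: incidence_algebra_def)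
  then show ?thesis
    by (auto simp: inc_mult_diagonal_right[where b = b] inc_mult_diagonal_left[where a = a]
        finite_X assms(1,2))
qed

lemma diagonal_idempotent_entry:
  assumes "e \<in> incidence_algebra r" "\<And>x y. x \<noteq> y \<Longrightarrow> e (x, y) = 0" "inc_mult X e e = e"
    and x: "x \<in> diag_support e"
  shows "x \<in> X" "e (x, x) = 1"
proof -
  have nz: "e (x, x) \<noteq> 0" using x by (simp add: diag_support_def)
  then show "x \<in> X" using assms(1) r_in_X by (auto simp: incidence_algebra_def)
  then have "e (x, x) * e (x, x) = e (x, x)"
    using fun_cong[OF assms(3), of "(x, x)"] finite_X assms(2)
    by (simp add: inc_mult_diagonal_left)
  then show "e (x, x) = 1" using nz by simp
qed

text \<open>The diagonal entries of both idempotents are 0 or 1, so multiplying by them only erases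
  the rows and columns outside the supports.\<close>

lemma peirce_diagonal:
  assumes e: "e \<in> incidence_algebra r" "\<And>x y. x \<noteq> y \<Longrightarrow> e (x, y) = 0" "inc_mult X e e = e"
    and f: "f \<in> incidence_algebra r" "\<And>x y. x \<noteq> y \<Longrightarrow> f (x, y) = 0" "inc_mult X f f = f"
  shows "peirce X r e f =
    {v. \<forall>x y. v (x, y) \<noteq> 0 \<longrightarrow> (x, y) \<in> r \<and> x \<in> diag_support e \<and> y \<in> diag_support f}"
    (is "_ = ?S")
proof
  show "peirce X r e f \<subseteq> ?S"
    by (auto simp: peirce_def inc_mult_diagonal e f diag_support_def)
       (auto simp: incidence_algebra_def)
  show "?S \<subseteq> peirce X r e f"
  proof
    fix v assume v: "v \<in> ?S"
    then have inc: "v \<in> incidence_algebra r" by (auto simp: incidence_algebra_def)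
    have "inc_mult X (inc_mult X e v) f (x, y) = v (x, y)" for x y
      using v diagonal_idempotent_entry(2)[OF e, of x] diagonal_idempotent_entry(2)[OF f, of y]
      by (cases "v (x, y) = 0") (auto simp: inc_mult_diagonal e(2) f(2) inc)
    then have "v = inc_mult X (inc_mult X e v) f" by (auto simp: fun_eq_iff)
    then show "v \<in> peirce X r e f" using inc by (auto simp: peirce_def)
  qed
qed

end

section \<open>One diagonal block: commutativity, antichain support, weights\<close>

locale diagonal_block = graded_incidence_algebra G X r A
  for G (structure) and X :: "'x set" and r and A :: "'a \<Rightarrow> ('x \<times> 'x \<Rightarrow> 'f::field) set" +
  fixes H :: "'a set" and e :: "'x \<times> 'x \<Rightarrow> 'f" and \<phi> :: "('a \<Rightarrow> 'f) \<Rightarrow> 'x \<times> 'x \<Rightarrow> 'f"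
  assumes subgroup_H: "subgroup H G" and finite_H: "finite H"
    and char_H: "\<not> CHAR('f) dvd card H"
    and e_inc: "e \<in> incidence_algebra r"
    and e_diag: "\<And>x y. x \<noteq> y \<Longrightarrow> e (x, y) = 0"
    and e_idem: "inc_mult X e e = e"
    and iso: "graded_algebra_iso G (galg H) (galg_mult G) (galg_grading H)
      (peirce X r e e) (inc_mult X) (induced_grading A (peirce X r e e)) \<phi>"
begin

sublocale H: subgroup H G by (rule subgroup_H)

lemma iso_add: "a \<in> galg H \<Longrightarrow> b \<in> galg H \<Longrightarrow> \<phi> (a + b) = \<phi> a + \<phi> b"
  and iso_scale: "a \<in> galg H \<Longrightarrow> \<phi> (fscale c a) = fscale c (\<phi> a)"
  and iso_bij: "bij_betw \<phi> (galg H) (peirce X r e e)"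
  and iso_mult: "a \<in> galg H \<Longrightarrow> b \<in> galg H \<Longrightarrow> \<phi> (galg_mult G a b) = inc_mult X (\<phi> a) (\<phi> b)"
  and iso_grading: "g \<in> carrier G \<Longrightarrow> \<phi> ` galg_grading H g = peirce X r e e \<inter> A g"
  using iso by (auto simp: graded_algebra_iso_def graded_space_iso_def induced_grading_def)

lemma iso_in_block: "a \<in> galg H \<Longrightarrow> \<phi> a \<in> peirce X r e e"
  using iso_bij by (auto dest: bij_betwE)

lemma iso_inj: "a \<in> galg H \<Longrightarrow> b \<in> galg H \<Longrightarrow> \<phi> a = \<phi> b \<Longrightarrow> a = b"
  using iso_bij by (auto simp: bij_betw_def dest: inj_onD)

lemma iso_zero: "\<phi> 0 = 0"
  using iso_scale[OF fun_vs.subspace_0[OF subspace_galg], of 0] by (simp only: fun_vs.scale_zero_left)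

lemma block_eq: "peirce X r e e =
    {v. \<forall>x y. v (x, y) \<noteq> 0 \<longrightarrow> (x, y) \<in> r \<and> x \<in> diag_support e \<and> y \<in> diag_support e}"
  by (rule peirce_diagonal) (fact e_inc e_diag e_idem)+

lemma iso_sum:
  assumes "a \<in> galg H"
  shows "\<phi> a = (\<Sum>h\<in>H. fscale (a h) (\<phi> (galg_basis h)))"
proof -
  \<comment> \<open>\<open>\<phi>\<close> is additive on \<open>galg H\<close> only, so the
    induction must check that the partial sums stay there.\<close>
  have "\<phi> (\<Sum>h\<in>S. fscale (a h) (galg_basis h)) = (\<Sum>h\<in>S. fscale (a h) (\<phi> (galg_basis h)))"
    if "finite S" "S \<subseteq> H" for S
    using that
  proof (induction S)
    case empty
    then show ?case by (simp only: sum.empty iso_zero)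
  next
    case (insert h S)
    have "(\<Sum>h\<in>S. fscale (a h) (galg_basis h)) \<in> galg H"
      using insert.prems
      by (intro fun_vs.subspace_sum[OF subspace_galg] fun_vs.subspace_scale[OF subspace_galg]
          galg_basis_in_galg) auto
    moreover have "galg_basis h \<in> galg H" using insert.prems by (intro galg_basis_in_galg) auto
    ultimately have "\<phi> (fscale (a h) (galg_basis h) + (\<Sum>h\<in>S. fscale (a h) (galg_basis h))) =
        fscale (a h) (\<phi> (galg_basis h)) + \<phi> (\<Sum>h\<in>S. fscale (a h) (galg_basis h))"
      by (subst iso_add) (rule fun_vs.subspace_scale[OF subspace_galg], assumption+, simp only: iso_scale)
    then show ?case
      using insert.IH insert.prems unfolding sum.insert[OF insert.hyps] by (simp only: insert_subset simp_thms)
  qed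
  from this[OF finite_H order.refl] show ?thesis
    using galg_sum_basis[OF finite_H assms] by simp
qed

lemma iso_basis_mult:
  "h \<in> H \<Longrightarrow> k \<in> H \<Longrightarrow>
    inc_mult X (\<phi> (galg_basis h)) (\<phi> (galg_basis k)) = \<phi> (galg_basis (h \<otimes> k))"
  by (simp add: galg_basis_in_galg flip: iso_mult galg_mult_basis_basis)

text \<open>Every block element is the image of a combination of elements of \<open>H\<close>, and
  these commute because \<open>G\<close> is abelian.\<close>

lemma block_commute:
  assumes "p \<in> peirce X r e e" "q \<in> peirce X r e e"
  shows "inc_mult X p q = inc_mult X q p"
proof -
  obtain a b where ab: "a \<in> galg H" "b \<in> galg H" "p = \<phi> a" "q = \<phi> b"
    using assms iso_bij unfolding bij_betw_def by (metis imageE)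
  have expand: "inc_mult X (\<phi> a) (\<phi> b) =
      (\<Sum>h\<in>H. \<Sum>k\<in>H. fscale (a h * b k) (\<phi> (galg_basis (h \<otimes> k))))"
    if "a \<in> galg H" "b \<in> galg H" for a b
    unfolding iso_sum[OF that(1)] iso_sum[OF that(2)] inc_mult_sum_left inc_mult_fscale_left
      inc_mult_sum_right inc_mult_fscale_right
    by (subst sum.swap) (simp add: iso_basis_mult fun_vs.scale_sum_right mult.commute)
  have "inc_mult X p q = (\<Sum>k\<in>H. \<Sum>h\<in>H. fscale (a h * b k) (\<phi> (galg_basis (h \<otimes> k))))"
    unfolding ab expand[OF ab(1,2)] by (rule sum.swap)
  also have "\<dots> = (\<Sum>k\<in>H. \<Sum>h\<in>H. fscale (b k * a h) (\<phi> (galg_basis (k \<otimes> h))))"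
  proof (intro sum.cong refl)
    fix k h assume "k \<in> H" "h \<in> H"
    then have "h \<otimes> k = k \<otimes> h" by (intro m_comm) auto
    then show "fscale (a h * b k) (\<phi> (galg_basis (h \<otimes> k))) =
        fscale (b k * a h) (\<phi> (galg_basis (k \<otimes> h)))" by (simp only: mult.commute)
  qed
  also have "\<dots> = inc_mult X q p" unfolding ab expand[OF ab(2,1)] ..
  finally show ?thesis .
qed

lemma mat_unit_in_block:
  "(x, y) \<in> r \<Longrightarrow> x \<in> diag_support e \<Longrightarrow> y \<in> diag_support e \<Longrightarrow> mat_unit x y \<in> peirce X r e e"
  by (auto simp: block_eq mat_unit_def)

lemma diag_support_in_X: "x \<in> diag_support e \<Longrightarrow> x \<in> X"
  by (rule diagonal_idempotent_entry[OF e_inc e_diag e_idem])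

text \<open>If \<open>x\<close> and \<open>y\<close> were distinct, the matrix unit at
  \<open>(x, y)\<close> would be fixed by left multiplication with that at \<open>(x, x)\<close> and
  killed by right multiplication, against commutativity of the block.\<close>

lemma block_antichain:
  assumes "(x, y) \<in> r" "x \<in> diag_support e" "y \<in> diag_support e"
  shows "x = y"
proof (rule ccontr)
  assume "x \<noteq> y"
  have X: "x \<in> X" using assms diag_support_in_X by blast
  have diag: "mat_unit x x (a, b) = (0::'f)" if "a \<noteq> b" for a b using that by (auto simp: mat_unit_def)
  have "inc_mult X (mat_unit x x) (mat_unit x y :: 'x \<times> 'x \<Rightarrow> 'f) =
      inc_mult X (mat_unit x y) (mat_unit x x)"
    using assms X r_refl by (intro block_commute mat_unit_in_block) auto
  from fun_cong[OF this, of "(x, y)"] show False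
    using X \<open>x \<noteq> y\<close>
    by (simp add: inc_mult_diagonal_left[where a = "mat_unit x x"] diag finite_X
        inc_mult_diagonal_right[where b = "mat_unit x x"])
       (simp add: mat_unit_def split: if_splits)
qed

lemma iso_diag: "a \<in> galg H \<Longrightarrow> x \<noteq> y \<Longrightarrow> \<phi> a (x, y) = 0"
  using iso_in_block[of a] block_antichain[of x y] by (auto simp: block_eq)

lemma iso_mult_left:
  assumes "a \<in> galg H"
  shows "inc_mult X (\<phi> a) v (x, y) = (if x \<in> X then \<phi> a (x, x) * v (x, y) else 0)"
  using finite_X iso_diag[OF assms] by (rule inc_mult_diagonal_left)

lemma iso_mult_right:
  assumes "a \<in> galg H"
  shows "inc_mult X v (\<phi> a) (x, y) = (if y \<in> X then v (x, y) * \<phi> a (y, y) else 0)"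
  using finite_X iso_diag[OF assms] by (rule inc_mult_diagonal_right)

lemma iso_basis_homogeneous: "h \<in> H \<Longrightarrow> \<phi> (galg_basis h) \<in> A h"
  using iso_grading[of h] galg_basis_in_grading[of h H] by auto

lemma weight_eq_0: "h \<in> H \<Longrightarrow> x \<notin> diag_support e \<Longrightarrow> weight \<phi> x h = 0"
  using iso_in_block[OF galg_basis_in_galg, of h] by (auto simp: block_eq weight_def)

lemma weight_mult:
  assumes "h \<in> H" "k \<in> H" "x \<in> diag_support e"
  shows "weight \<phi> x (h \<otimes> k) = weight \<phi> x h * weight \<phi> x k"
  unfolding weight_def iso_basis_mult[OF assms(1,2), symmetric]
  using diag_support_in_X[OF assms(3)] assms(1) by (simp add: iso_mult_left galg_basis_in_galg)

lemma mat_unit_mult_left: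
  assumes "a \<in> galg H" "x \<in> X"
  shows "inc_mult X (\<phi> a) (mat_unit x x) = fscale (\<phi> a (x, x)) (mat_unit x x)"
proof
  fix p :: "'x \<times> 'x"
  obtain y z where p: "p = (y, z)" by fastforce
  show "inc_mult X (\<phi> a) (mat_unit x x) p = fscale (\<phi> a (x, x)) (mat_unit x x) p"
    using assms by (simp add: p iso_mult_left) (simp add: mat_unit_def)
qed

lemma mat_unit_in_image:
  assumes "x \<in> diag_support e"
  obtains a where "a \<in> galg H" "\<phi> a = mat_unit x x"
proof -
  have "mat_unit x x \<in> \<phi> ` galg H"
    using iso_bij assms diag_support_in_X r_refl mat_unit_in_block by (auto simp: bij_betw_def)
  then show ?thesis using that by force
qed

text \<open>Preservation of the unit is not part of \<open>graded_algebra_iso\<close>. Instead the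
  group identity fixes the preimage of the matrix unit at \<open>(x, x)\<close>, which forces its
  eigenvalue at \<open>x\<close> to be 1.\<close>

lemma weight_one:
  assumes x: "x \<in> diag_support e"
  shows "weight \<phi> x \<one> = 1"
proof -
  obtain a where a: "a \<in> galg H" "\<phi> a = mat_unit x x" using x by (rule mat_unit_in_image)
  have "galg_mult G (galg_basis \<one>) a = a"
    using a(1) finite_H H.subset by (auto simp: fun_eq_iff galg_mult_basis galg_finite)
  then have "inc_mult X (\<phi> (galg_basis \<one>)) (\<phi> a) = \<phi> a"
    using a(1) by (simp add: galg_basis_in_galg flip: iso_mult)
  then have "fscale (weight \<phi> x \<one>) (mat_unit x x) (x, x) = (mat_unit x x (x, x) :: 'f)"
    unfolding a(2) using diag_support_in_X[OF x] by (simp add: mat_unit_mult_left galg_basis_in_galg weight_def)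
  then show ?thesis by (simp add: mat_unit_def)
qed

lemma weight_inv:
  assumes "h \<in> H" "x \<in> diag_support e"
  shows "weight \<phi> x (inv h) * weight \<phi> x h = 1"
  using assms weight_mult[of "inv h" h x] weight_one by simp

text \<open>The preimage of the matrix unit is the idempotent of the group algebra belonging to the
  character \<open>weight \<phi> x\<close>, up to the scalar \<open>a \<one>\<close>. Indeed
  \<open>g\<close> acts on the matrix unit by \<open>weight \<phi> x g\<close>, hence also on
  \<open>a\<close>, which determines \<open>a\<close> by its coefficient at the identity.\<close>

lemma mat_unit_eq_iso:
  assumes x: "x \<in> diag_support e"
  obtains a where "a \<in> galg H" "\<phi> a = mat_unit x x" "a \<one> \<noteq> 0"
    "\<And>g. g \<in> H \<Longrightarrow> a g = a \<one> * weight \<phi> x (inv g)"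
proof -
  obtain a where a: "a \<in> galg H" "\<phi> a = mat_unit x x" using x by (rule mat_unit_in_image)
  have rel: "a g = a \<one> * weight \<phi> x (inv g)" if g: "g \<in> H" for g
  proof -
    have "inv g \<otimes> k \<in> H \<Longrightarrow> k \<in> H" if "k \<in> carrier G" for k
      using that g H.m_closed[of g "inv g \<otimes> k"] by (simp add: m_assoc[symmetric])
    then have gal: "galg_mult G (galg_basis g) a \<in> galg H"
      unfolding galg_finite[OF finite_H] mem_Collect_eq galg_mult_basis[OF H.mem_carrier[OF g]]
      using a(1) unfolding galg_finite[OF finite_H] mem_Collect_eq by metis
    have "\<phi> (galg_mult G (galg_basis g) a) = \<phi> (fscale (weight \<phi> x g) a)"
      using g a diag_support_in_X[OF x]
      by (simp add: iso_mult iso_scale galg_basis_in_galg mat_unit_mult_left weight_def)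
    then have "galg_mult G (galg_basis g) a = fscale (weight \<phi> x g) a"
      using gal a(1) fun_vs.subspace_scale[OF subspace_galg] by (intro iso_inj) blast+
    \<comment> \<open>Coefficients at \<open>g\<close> are compared; translation by \<open>g\<close>
      moves the coefficient at the identity there.\<close>
    from fun_cong[OF this, of g] have "a \<one> = weight \<phi> x g * a g"
      using g by (simp add: galg_mult_basis)
    then show ?thesis using weight_inv[OF g x] by (simp add: algebra_simps)
  qed
  have "a \<one> \<noteq> 0"
  proof
    assume "a \<one> = 0"
    then have "a g = 0" for g
      using rel[of g] a(1) unfolding galg_finite[OF finite_H] by (cases "g \<in> H") simp_all
    then have "a = 0" by (simp add: fun_eq_iff)
    then have "mat_unit x x = (0 :: 'x \<times> 'x \<Rightarrow> 'f)" using a(2) iso_zero by (simp only:)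
    then show False by (simp only: mat_unit_neq_0)
  qed
  then show ?thesis using that a rel by blast
qed

end

subsection \<open>Off-diagonal blocks\<close>

locale block_pair = graded_incidence_algebra G X r A +
  left: diagonal_block G X r A H e \<phi> + right: diagonal_block G X r A K f \<psi>
  for G (structure) and X :: "'x set" and r and A :: "'a \<Rightarrow> ('x \<times> 'x \<Rightarrow> 'f::field) set"
    and H e \<phi> K f \<psi>
begin

definition pairs :: "('x \<times> 'x) set" where
  "pairs = {p \<in> r. fst p \<in> diag_support e \<and> snd p \<in> diag_support f}"

text \<open>This is the quotient of the row weight by the column weight, the division being
  evaluation at \<open>inv h\<close>. The \<open>restrict\<close> makes it extensional, as
  \<open>characters\<close> demands.\<close>

definition pair_char :: "'x \<times> 'x \<Rightarrow> 'a \<Rightarrow> 'f" where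
  "pair_char p = restrict (\<lambda>h. weight \<phi> (fst p) h * weight \<psi> (snd p) (inv h)) (H \<inter> K)"

text \<open>For a character, this is the component on which each \<open>c\<close> in
  \<open>H \<inter> K\<close> acts by the scalar \<open>\<chi> c\<close> under conjugation
  \<open>v \<mapsto> c v c^-1\<close>. That action scales entries, so the component is described by
  supports.\<close>

definition isotypic :: "('a \<Rightarrow> 'f) \<Rightarrow> ('x \<times> 'x \<Rightarrow> 'f) set" where
  "isotypic \<chi> = {v. \<forall>p. v p \<noteq> 0 \<longrightarrow> p \<in> pairs \<and> pair_char p = \<chi>}"

definition act :: "'a \<Rightarrow> ('x \<times> 'x \<Rightarrow> 'f) \<Rightarrow> 'a \<Rightarrow> 'x \<times> 'x \<Rightarrow> 'f" where
  "act h v k = inc_mult X (inc_mult X (\<phi> (galg_basis h)) v) (\<psi> (galg_basis k))"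

lemma subgroup_Int: "subgroup (H \<inter> K) G"
  using left.subgroup_H right.subgroup_H by (rule subgroups_Inter_pair)

text \<open>By Lagrange this order divides that of \<open>H\<close>, which the characteristic does
  not divide.\<close>

lemma card_Int_neq_0: "of_nat (card (H \<inter> K)) \<noteq> (0 :: 'f)"
proof -
  interpret GH: group "G\<lparr>carrier := H\<rparr>" by (rule left.H.subgroup_is_group[OF group_axioms])
  have "subgroup (H \<inter> K) (G\<lparr>carrier := H\<rparr>)"
    using subgroup_Int left.subgroup_H by (rule subgroup_incl) simp
  from GH.lagrange[OF this] have "card (H \<inter> K) dvd card H"
    by (simp add: order_def) (metis dvd_triv_right)
  then show ?thesis using left.char_H dvd_trans by (auto simp: of_nat_eq_0_iff_char_dvd)
qed

lemma finite_pairs: "finite pairs"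
proof (rule finite_subset)
  show "pairs \<subseteq> X \<times> X" using r_in_X by (auto simp: pairs_def)
qed (use finite_X in simp)

lemma peirce_eq: "peirce X r e f = {v. \<forall>p. v p \<noteq> 0 \<longrightarrow> p \<in> pairs}"
  by (subst peirce_diagonal)
     (auto simp: left.e_inc left.e_diag left.e_idem right.e_inc right.e_diag right.e_idem pairs_def)

lemma subspace_isotypic: "fun_vs.subspace (isotypic \<chi>)"
  by (rule fun_vs.subspaceI) (auto simp: isotypic_def, (metis add.left_neutral)+)

lemma isotypicD: "v \<in> isotypic \<chi> \<Longrightarrow> v p \<noteq> 0 \<Longrightarrow> p \<in> pairs \<and> pair_char p = \<chi>"
  unfolding isotypic_def by blast

lemma isotypic_subset_peirce: "isotypic \<chi> \<subseteq> peirce X r e f"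
  by (auto simp: isotypic_def peirce_eq)

lemma peirce_subset_incidence: "peirce X r e f \<subseteq> incidence_algebra r"
  by (auto simp: peirce_eq incidence_algebra_def pairs_def)

lemma pair_char_in_characters:
  assumes "p \<in> pairs"
  shows "pair_char p \<in> characters G (H \<inter> K)"
proof -
  have nz: "weight \<phi> (fst p) h * weight \<psi> (snd p) (inv h) \<noteq> 0" if "h \<in> H \<inter> K" for h
    using left.weight_inv[of h "fst p"] right.weight_inv[of h "snd p"] assms that
    by (auto simp: pairs_def)
  have "weight \<phi> (fst p) (h \<otimes> k) * weight \<psi> (snd p) (inv (h \<otimes> k)) =
      weight \<phi> (fst p) h * weight \<psi> (snd p) (inv h) * (weight \<phi> (fst p) k * weight \<psi> (snd p) (inv k))"
    if "h \<in> H \<inter> K" "k \<in> H \<inter> K" for h k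
    using assms that by (simp add: left.weight_mult right.weight_mult pairs_def inv_mult)
  with nz show ?thesis
    unfolding pair_char_def characters_def hom_def field_units_def by auto
qed

lemma pair_char_weights:
  assumes "p \<in> pairs" "h \<in> H \<inter> K"
  shows "weight \<phi> (fst p) h = pair_char p h * weight \<psi> (snd p) h"
  using right.weight_inv[of h "snd p"] assms by (simp add: pair_char_def pairs_def)

section \<open>The action of the two group algebras on an off-diagonal block\<close>

lemma bimodule_apply:
  assumes "a \<in> galg H" "b \<in> galg K" "v \<in> incidence_algebra r"
  shows "inc_mult X (inc_mult X (\<phi> a) v) (\<psi> b) p = \<phi> a (fst p, fst p) * v p * \<psi> b (snd p, snd p)"
proof -
  have "inc_mult X (inc_mult X (\<phi> a) v) (\<psi> b) (x, y) = \<phi> a (x, x) * v (x, y) * \<psi> b (y, y)" for x y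
    using left.iso_diag[OF assms(1)] right.iso_diag[OF assms(2)] assms(3) by (rule inc_mult_diagonal)
  from this[of "fst p" "snd p"] show ?thesis by (simp only: prod.collapse)
qed

lemma act_apply:
  assumes "h \<in> H" "k \<in> K" "v \<in> incidence_algebra r"
  shows "act h v k p = weight \<phi> (fst p) h * v p * weight \<psi> (snd p) k"
  unfolding act_def weight_def using assms by (intro bimodule_apply galg_basis_in_galg)

lemma act_homogeneous:
  assumes "h \<in> H" "k \<in> K" "g \<in> carrier G" "v \<in> A g"
  shows "act h v k \<in> A (g \<otimes> (h \<otimes> k))"
proof -
  have "act h v k \<in> A (h \<otimes> g \<otimes> k)"
    unfolding act_def using assms
    by (intro homogeneous_mult left.iso_basis_homogeneous right.iso_basis_homogeneous) auto
  then show ?thesis using assms by (simp add: m_ac)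
qed

text \<open>A single sum over pairs, with homogeneous terms when \<open>v\<close> is homogeneous, is
  the form in which degrees can be compared.\<close>

lemma bimodule_expand:
  assumes "a \<in> galg H" "b \<in> galg K"
  shows "inc_mult X (inc_mult X (\<phi> a) v) (\<psi> b) =
    (\<Sum>t\<in>H \<times> K. fscale (a (fst t) * b (snd t)) (act (fst t) v (snd t)))"
proof -
  have "inc_mult X (inc_mult X (\<phi> a) v) (\<psi> b) =
      (\<Sum>h\<in>H. inc_mult X (fscale (a h) (inc_mult X (\<phi> (galg_basis h)) v)) (\<psi> b))"
    by (subst left.iso_sum[OF assms(1)]) (simp only: inc_mult_sum_left inc_mult_fscale_left)
  also have "\<dots> = (\<Sum>h\<in>H. \<Sum>k\<in>K. fscale (a h * b k) (act h v k))"
    by (subst right.iso_sum[OF assms(2)])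
       (simp only: inc_mult_sum_right inc_mult_fscale_right inc_mult_fscale_left act_def
          fun_vs.scale_scale mult.commute)
  also have "\<dots> = (\<Sum>t\<in>H \<times> K. fscale (a (fst t) * b (snd t)) (act (fst t) v (snd t)))"
    by (simp only: sum.cartesian_product case_prod_unfold)
  finally show ?thesis .
qed

text \<open>Both sides scale each entry of \<open>m\<close>; at a nonzero entry the pair character
  is \<open>\<chi>\<close>, which is exactly the ratio of the two scalars.\<close>

lemma isotypic_left_right:
  assumes "m \<in> isotypic \<chi>" "h \<in> H \<inter> K"
  shows "inc_mult X (\<phi> (galg_basis h)) m = fscale (\<chi> h) (inc_mult X m (\<psi> (galg_basis h)))"
proof
  fix p :: "'x \<times> 'x"
  obtain x y where p: "p = (x, y)" by fastforce
  have h: "h \<in> H" "h \<in> K" using assms by auto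
  have X: "x \<in> X \<and> y \<in> X" if "m p \<noteq> 0"
    using isotypicD[OF assms(1) that] p r_in_X[of x y] by (auto simp: pairs_def)
  have "weight \<phi> x h = \<chi> h * weight \<psi> y h" if "m p \<noteq> 0"
    using isotypicD[OF assms(1) that] assms(2) p pair_char_weights[of p h] by auto
  with X show "inc_mult X (\<phi> (galg_basis h)) m p =
      fscale (\<chi> h) (inc_mult X m (\<psi> (galg_basis h))) p"
    unfolding p fscale_apply weight_def
      left.iso_mult_left[OF galg_basis_in_galg[OF h(1)]]
      right.iso_mult_right[OF galg_basis_in_galg[OF h(2)]]
    by (cases "m (x, y) = 0") auto
qed

lemma act_isotypic_inv:
  assumes m: "m \<in> isotypic \<chi>" and c: "c \<in> H \<inter> K"
  shows "act c m (inv c) = fscale (\<chi> c) m"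
proof
  fix p
  have inc: "m \<in> incidence_algebra r"
    using m isotypic_subset_peirce peirce_subset_incidence by blast
  have "weight \<phi> (fst p) c * weight \<psi> (snd p) (inv c) = \<chi> c" if "m p \<noteq> 0"
    using isotypicD[OF m that] c by (auto simp: pair_char_def)
  then show "act c m (inv c) p = fscale (\<chi> c) m p"
    using c inc by (cases "m p = 0") (auto simp: act_apply)
qed

text \<open>If \<open>m\<close> vanishes at \<open>(x, y)\<close>, then multiplying it by the two diagonal matrix units of \<open>x\<close> and
  \<open>y\<close> gives \<open>0\<close>. The matrix units are combinations of group elements, and the degree \<open>d\<close> component
  of the product comes from the terms \<open>c m c\<^sup>-\<^sup>1\<close>; it is a nonzero multiple of \<open>m\<close>.\<close>

lemma homogeneous_isotypic_full_support:
  assumes m: "m \<in> isotypic \<chi>" "m \<in> A d" "d \<in> carrier G" "m \<noteq> 0"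
    and p: "p \<in> pairs" "pair_char p = \<chi>"
  shows "m p \<noteq> 0"
proof
  assume "m p = 0"
  obtain x y where xy: "p = (x, y)" by fastforce
  have x: "x \<in> diag_support e" and y: "y \<in> diag_support f" using p xy by (auto simp: pairs_def)
  obtain a where a: "a \<in> galg H" "\<phi> a = mat_unit x x" "a \<one> \<noteq> 0"
      "\<And>g. g \<in> H \<Longrightarrow> a g = a \<one> * weight \<phi> x (inv g)"
    using left.mat_unit_eq_iso[OF x] by blast
  obtain b where b: "b \<in> galg K" "\<psi> b = mat_unit y y" "b \<one> \<noteq> 0"
      "\<And>g. g \<in> K \<Longrightarrow> b g = b \<one> * weight \<psi> y (inv g)"
    using right.mat_unit_eq_iso[OF y] by blast
  have inc: "m \<in> incidence_algebra r"
    using m isotypic_subset_peirce peirce_subset_incidence by blast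
  have "inc_mult X (inc_mult X (\<phi> a) m) (\<psi> b) (x', y') = 0" for x' y'
    using bimodule_apply[OF a(1) b(1) inc, of "(x', y')"] \<open>m p = 0\<close>
    unfolding a b xy by (auto simp: mat_unit_def)
  then have "inc_mult X (inc_mult X (\<phi> a) m) (\<psi> b) = 0" by (auto simp: fun_eq_iff)
  then have zero: "(\<Sum>t\<in>H \<times> K. fscale (a (fst t) * b (snd t)) (act (fst t) m (snd t))) = 0"
    unfolding bimodule_expand[OF a(1) b(1)] .
  have deg: "d \<otimes> (fst t \<otimes> snd t) \<in> carrier G \<and>
      fscale (a (fst t) * b (snd t)) (act (fst t) m (snd t)) \<in> A (d \<otimes> (fst t \<otimes> snd t))"
    if "t \<in> H \<times> K" for t
    using that m act_homogeneous[of "fst t" "snd t" d m]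
    by (auto intro!: fun_vs.subspace_scale subspace_homogeneous)
  have "(\<Sum>t | t \<in> H \<times> K \<and> d \<otimes> (fst t \<otimes> snd t) = d.
      fscale (a (fst t) * b (snd t)) (act (fst t) m (snd t))) = 0"
    by (rule is_direct_sum_homogeneous_part_eq_0[OF direct_sum _ deg zero m(3)])
       (simp_all add: left.finite_H right.finite_H)
  \<comment> \<open>Degree \<open>d\<close> forces \<open>h \<otimes> k = \<one>\<close>, so
    \<open>k\<close> is the inverse of \<open>h\<close> and both lie in
    \<open>H \<inter> K\<close>.\<close>
  moreover have "{t. t \<in> H \<times> K \<and> d \<otimes> (fst t \<otimes> snd t) = d} = (\<lambda>c. (c, inv c)) ` (H \<inter> K)"
    (is "?L = ?R")
  proof
    show "?L \<subseteq> ?R"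
    proof
      fix t assume "t \<in> ?L"
      then obtain h k where t: "t = (h, k)" "h \<in> H" "k \<in> K" "d \<otimes> (h \<otimes> k) = d" by auto
      then have "h \<otimes> k = \<one>" using m(3) by (simp add: l_cancel_one)
      then have "k = inv h" using t by (metis inv_equality left.H.mem_carrier m_comm right.H.mem_carrier)
      then have "h \<in> K" using t right.H.m_inv_closed[of k] by simp
      then show "t \<in> ?R" using t \<open>k = inv h\<close> by auto
    qed
    show "?R \<subseteq> ?L" using m(3) by auto
  qed
  ultimately have "(\<Sum>c\<in>H \<inter> K. fscale (a c * b (inv c)) (act c m (inv c))) = 0"
    by (simp add: sum.reindex inj_on_def)
  moreover have "fscale (a c * b (inv c)) (act c m (inv c)) = fscale (a \<one> * b \<one>) m"
    if c: "c \<in> H \<inter> K" for c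
  proof -
    \<comment> \<open>The weights hidden in \<open>a c\<close>, \<open>b (inv c)\<close> and
      \<open>\<chi> c\<close> cancel in pairs. All terms thus equal the same multiple of
      \<open>m\<close>, and their number is nonzero in the field.\<close>
    have "a c * b (inv c) * \<chi> c =
        a \<one> * b \<one> * (weight \<phi> x (inv c) * weight \<phi> x c) * (weight \<psi> y (inv c) * weight \<psi> y c)"
      using c p xy a(4)[of c] b(4)[of "inv c"] by (auto simp: pair_char_def)
    then show ?thesis
      using c x y by (simp add: act_isotypic_inv[OF m(1) c] left.weight_inv right.weight_inv)
  qed
  ultimately have "(\<Sum>c\<in>H \<inter> K. fscale (a \<one> * b \<one>) m) = 0" by simp
  then have "fscale (of_nat (card (H \<inter> K))) (fscale (a \<one> * b \<one>) m) = 0"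
    by (simp only: fun_vs.sum_constant_scale)
  then show False
    using a(3) b(3) m(4) card_Int_neq_0 by (simp only: fun_vs.scale_eq_0_iff mult_eq_0_iff) simp
qed

text \<open>The operator \<open>T\<close> is \<open>|H \<inter> K|\<close> times the projection onto the isotypic component of \<open>\<chi>\<close>; it preserves degrees.\<close>

lemma homogeneous_isotypic_exists:
  assumes p: "p \<in> pairs" "pair_char p = \<chi>"
  obtains m d where "m \<in> isotypic \<chi>" "m \<noteq> 0" "d \<in> carrier G" "m \<in> A d"
proof -
  define T where "T v = (\<Sum>c\<in>H \<inter> K. fscale (1 / \<chi> c) (act c v (inv c)))" for v
  \<comment> \<open>At a position in \<open>pairs\<close>, \<open>T\<close> multiplies by a sum of
    character quotients, evaluated by orthogonality. Elsewhere in the incidence algebra one of the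
    two weights is 0, so \<open>T\<close> also cuts down to the block.\<close>
  have T_apply: "T v q = (if q \<in> pairs \<and> pair_char q = \<chi> then of_nat (card (H \<inter> K)) * v q else 0)"
    if v: "v \<in> incidence_algebra r" for v q
  proof (cases "q \<in> pairs")
    case True
    have "T v q = (\<Sum>c\<in>H \<inter> K. v q * (pair_char q c / \<chi> c))"
      unfolding T_def sum_apply using v by (intro sum.cong) (auto simp: act_apply pair_char_def)
    also have "\<dots> = v q * (\<Sum>c\<in>H \<inter> K. pair_char q c / \<chi> c)" by (simp only: sum_distrib_left)
    also have "(\<Sum>c\<in>H \<inter> K. pair_char q c / \<chi> c) =
        (if pair_char q = \<chi> then of_nat (card (H \<inter> K)) else 0)"
      using pair_char_in_characters[OF True] pair_char_in_characters[OF p(1)] p(2)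
      by (intro characters_orthogonal subgroup_Int) simp_all
    finally show ?thesis using True by simp
  next
    case False
    have "act c v (inv c) q = 0" if c: "c \<in> H \<inter> K" for c
    proof -
      have "v q = 0 \<or> weight \<phi> (fst q) c = 0 \<or> weight \<psi> (snd q) (inv c) = 0"
        using False v c left.weight_eq_0[of c "fst q"] right.weight_eq_0[of "inv c" "snd q"]
        by (cases q) (auto simp: pairs_def incidence_algebra_def)
      then show ?thesis using c v by (auto simp: act_apply)
    qed
    then show ?thesis using False by (simp add: T_def sum_apply)
  qed
  have p_r: "p \<in> r" using p by (simp add: pairs_def)
  have unit: "mat_unit (fst p) (snd p) \<in> incidence_algebra r"
    using p_r by (auto simp: incidence_algebra_def mat_unit_def)
  obtain S u where S: "finite S" "S \<subseteq> carrier G" "\<And>g. g \<in> S \<Longrightarrow> u g \<in> A g"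
      and sum: "mat_unit (fst p) (snd p) = (\<Sum>g\<in>S. u g)"
    by (rule is_direct_sum_decompose[OF direct_sum unit]) (rule that)
  \<comment> \<open>The matrix unit at \<open>p\<close> need not be homogeneous, but some
    homogeneous part \<open>u g\<close> is nonzero at \<open>p\<close>, and \<open>T\<close> keeps
    that entry up to a nonzero factor.\<close>
  have "(\<Sum>g\<in>S. u g p) = 1"
    using fun_cong[OF sum, of p] by (simp add: sum_apply mat_unit_def)
  then obtain g where g: "g \<in> S" "u g p \<noteq> 0" by (metis sum.neutral zero_neq_one)
  have inc: "u g \<in> incidence_algebra r" using g S homogeneous_subset by blast
  show ?thesis
  proof (rule that)
    show "T (u g) \<in> isotypic \<chi>" using T_apply[OF inc] by (auto simp: isotypic_def)
    have "T (u g) p \<noteq> 0" using T_apply[OF inc] p g card_Int_neq_0 by simp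
    then show "T (u g) \<noteq> 0" by auto
    show gG: "g \<in> carrier G" using g S by auto
    show "T (u g) \<in> A g"
      unfolding T_def
    proof (intro fun_vs.subspace_sum fun_vs.subspace_scale subspace_homogeneous gG)
      fix c assume "c \<in> H \<inter> K"
      then show "act c (u g) (inv c) \<in> A g"
        using act_homogeneous[of c "inv c" g "u g"] g S gG by auto
    qed
  qed
qed

text \<open>The actions scale entries and cannot enlarge the support of \<open>m\<close>.
  Conversely, cutting \<open>m\<close> with the matrix units at \<open>(x, x)\<close> and
  \<open>(y, y)\<close> leaves \<open>m (x, y)\<close> times the one at \<open>(x, y)\<close>, and
  this entry is invertible by \<open>full\<close>.\<close>

lemma cyclic_eq_isotypic:
  assumes m: "m \<in> isotypic \<chi>" and full: "\<And>p. p \<in> pairs \<Longrightarrow> pair_char p = \<chi> \<Longrightarrow> m p \<noteq> 0"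
  shows "cyclic_bimodule X H \<phi> m K \<psi> = isotypic \<chi>"
proof
  have inc: "m \<in> incidence_algebra r"
    using m isotypic_subset_peirce peirce_subset_incidence by blast
  show "cyclic_bimodule X H \<phi> m K \<psi> \<subseteq> isotypic \<chi>"
    unfolding cyclic_bimodule_def
  proof (rule fun_vs.span_minimal[OF _ subspace_isotypic])
    show "{inc_mult X (inc_mult X (\<phi> a) m) (\<psi> b) | a b. a \<in> galg H \<and> b \<in> galg K} \<subseteq> isotypic \<chi>"
    proof safe
      fix a b :: "'a \<Rightarrow> 'f" assume ab: "a \<in> galg H" "b \<in> galg K"
      show "inc_mult X (inc_mult X (\<phi> a) m) (\<psi> b) \<in> isotypic \<chi>"
        unfolding isotypic_def mem_Collect_eq bimodule_apply[OF ab inc]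
        using isotypicD[OF m] by (metis mult_zero_left mult_zero_right)
    qed
  qed
  show "isotypic \<chi> \<subseteq> cyclic_bimodule X H \<phi> m K \<psi>"
  proof
    fix v assume v: "v \<in> isotypic \<chi>"
    let ?S = "{p \<in> pairs. pair_char p = \<chi>}"
    have "v = (\<Sum>p\<in>?S. fscale (v p) (mat_unit (fst p) (snd p)))"
      using v finite_pairs by (intro function_as_sum_mat_unit) (auto simp: isotypic_def)
    also have "\<dots> \<in> cyclic_bimodule X H \<phi> m K \<psi>"
      unfolding cyclic_bimodule_def
    proof (intro fun_vs.span_sum fun_vs.span_scale)
      fix p assume p: "p \<in> ?S"
      obtain x y where xy: "p = (x, y)" by fastforce
      have xy_supp: "x \<in> diag_support e" "y \<in> diag_support f" using p xy by (auto simp: pairs_def)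
      obtain a where a: "a \<in> galg H" "\<phi> a = mat_unit x x"
        by (rule left.mat_unit_in_image[OF xy_supp(1)])
      obtain b where b: "b \<in> galg K" "\<psi> b = mat_unit y y"
        by (rule right.mat_unit_in_image[OF xy_supp(2)])
      have "inc_mult X (inc_mult X (\<phi> a) m) (\<psi> b) q = fscale (m p) (mat_unit x y) q" for q
        using bimodule_apply[OF a(1) b(1) inc, of q] unfolding a b xy
        by (cases q) (auto simp: mat_unit_def)
      then have "inc_mult X (inc_mult X (\<phi> a) m) (\<psi> b) = fscale (m p) (mat_unit x y)" by blast
      then have "fscale (1 / m p) (inc_mult X (inc_mult X (\<phi> a) m) (\<psi> b)) = mat_unit x y"
        using full[of p] p by (simp add: fun_eq_iff)
      moreover have "fscale (1 / m p) (inc_mult X (inc_mult X (\<phi> a) m) (\<psi> b)) \<in>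
          fun_vs.span {inc_mult X (inc_mult X (\<phi> a) m) (\<psi> b) | a b. a \<in> galg H \<and> b \<in> galg K}"
        using a b by (intro fun_vs.span_scale fun_vs.span_base) blast
      ultimately show "mat_unit (fst p) (snd p) \<in>
          fun_vs.span {inc_mult X (inc_mult X (\<phi> a) m) (\<psi> b) | a b. a \<in> galg H \<and> b \<in> galg K}"
        by (simp add: xy)
    qed
    finally show "v \<in> cyclic_bimodule X H \<phi> m K \<psi>" .
  qed
qed

text \<open>With \<open>c = inv h' \<otimes> h\<close>, which also equals
  \<open>k' \<otimes> inv k\<close> and so lies in \<open>H \<inter> K\<close>, the element
  \<open>h m k\<close> is \<open>h' (c m c^-1) k'\<close>, and conjugation by \<open>c\<close>
  scales \<open>m\<close> by \<open>\<chi> c\<close>.\<close>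

lemma act_isotypic_same_product:
  assumes m: "m \<in> isotypic \<chi>" and h: "h \<in> H" "h' \<in> H" and k: "k \<in> K" "k' \<in> K"
    and eq: "h \<otimes> k = h' \<otimes> k'"
  shows "act h m k = fscale (\<chi> (inv h' \<otimes> h)) (act h' m k')"
proof
  fix p
  have inc: "m \<in> incidence_algebra r"
    using m isotypic_subset_peirce peirce_subset_incidence by blast
  define c where "c = inv h' \<otimes> h"
  note carr = left.H.mem_carrier[OF h(1)] left.H.mem_carrier[OF h(2)]
    right.H.mem_carrier[OF k(1)] right.H.mem_carrier[OF k(2)]
  have "c \<otimes> k = inv h' \<otimes> (h' \<otimes> k')" unfolding c_def eq[symmetric] using carr by (simp add: m_assoc)
  also have "\<dots> = k'" using carr by (simp add: m_assoc[symmetric])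
  finally have ck: "c \<otimes> k = k'" .
  have cG: "c \<in> carrier G" using carr by (simp add: c_def)
  have "c = k' \<otimes> inv k" using ck cG carr by (simp add: inv_solve_right)
  then have "c \<in> K" using k by simp
  then have c: "c \<in> H \<inter> K" using h by (simp add: c_def)
  have h_eq: "h = h' \<otimes> c" using carr by (simp add: c_def m_assoc[symmetric])
  have k_eq: "k = inv c \<otimes> k'" using ck cG carr by (simp add: inv_solve_left)
  show "act h m k p = fscale (\<chi> (inv h' \<otimes> h)) (act h' m k') p"
  proof (cases "m p = 0")
    case True
    then show ?thesis using h k inc by (simp add: act_apply)
  next
    case False
    then have p: "p \<in> pairs" "pair_char p = \<chi>" using isotypicD[OF m] by auto
    then have supp: "fst p \<in> diag_support e" "snd p \<in> diag_support f" by (auto simp: pairs_def)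
    have "act h m k p = weight \<phi> (fst p) h' * weight \<phi> (fst p) c * m p *
        (weight \<psi> (snd p) (inv c) * weight \<psi> (snd p) k')"
      unfolding act_apply[OF h(1) k(1) inc] using h k c supp
      by (subst h_eq, subst k_eq) (simp add: left.weight_mult right.weight_mult)
    also have "\<dots> = \<chi> c * act h' m k' p"
      unfolding act_apply[OF h(2) k(2) inc] using c p by (auto simp: pair_char_def)
    finally show ?thesis by (simp add: c_def)
  qed
qed

text \<open>One product \<open>h m k\<close> for each element \<open>h \<otimes> k\<close> of
  \<open>H <#> K\<close> suffices to span, since another factorization changes it by a scalar only.
  These products are nonzero because weights on the supports are invertible, and their degrees are
  \<open>d\<close> times the element.\<close>

lemma cyclic_graded_iso:
  assumes m: "m \<in> isotypic \<chi>" "m \<in> A d" "d \<in> carrier G" "m \<noteq> 0"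
  defines "B \<equiv> cyclic_bimodule X H \<phi> m K \<psi>"
  shows "\<exists>\<theta>. graded_space_iso G B (induced_grading A B) (galg (H <#> K))
    (shift_grading G d (galg_grading (H <#> K))) \<theta>"
proof -
  have inc: "m \<in> incidence_algebra r"
    using m isotypic_subset_peirce peirce_subset_incidence by blast
  have HK: "H <#> K = (\<lambda>(h, k). h \<otimes> k) ` (H \<times> K)" by (auto simp: set_mult_def)
  have "\<exists>h k. h \<in> H \<and> k \<in> K \<and> g = h \<otimes> k" if "g \<in> H <#> K" for g
    using that by (auto simp: set_mult_def)
  \<comment> \<open>A factorization is chosen for each element of \<open>H <#> K\<close>; it need
    not be unique.\<close>
  then obtain hh kk where hk: "\<And>g. g \<in> H <#> K \<Longrightarrow> hh g \<in> H \<and> kk g \<in> K \<and> g = hh g \<otimes> kk g"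
    by metis
  define b where "b g = act (hh g) m (kk g)" for g
  have act_span: "act h m k \<in> fun_vs.span (b ` (H <#> K))" if "h \<in> H" "k \<in> K" for h k
  proof -
    have g: "h \<otimes> k \<in> H <#> K" using that by (auto simp: set_mult_def)
    have "act h m k = fscale (\<chi> (inv (hh (h \<otimes> k)) \<otimes> h)) (b (h \<otimes> k))"
      unfolding b_def using that hk[OF g] by (intro act_isotypic_same_product[OF m(1)]) auto
    then show ?thesis using g by (simp only: fun_vs.span_scale fun_vs.span_base imageI)
  qed
  have "B = fun_vs.span (b ` (H <#> K))"
    unfolding B_def cyclic_bimodule_def
  proof (rule fun_vs.span_eq[THEN iffD2], intro conjI subsetI)
    fix v assume "v \<in> {inc_mult X (inc_mult X (\<phi> a) m) (\<psi> b) | a b. a \<in> galg H \<and> b \<in> galg K}"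
    then obtain a c where "a \<in> galg H" "c \<in> galg K" "v = inc_mult X (inc_mult X (\<phi> a) m) (\<psi> c)"
      by blast
    then show "v \<in> fun_vs.span (b ` (H <#> K))"
      by (auto simp only: bimodule_expand intro!: fun_vs.span_sum fun_vs.span_scale act_span) auto
  next
    fix v assume "v \<in> b ` (H <#> K)"
    then obtain g where "g \<in> H <#> K" "v = b g" by auto
    then have "v = inc_mult X (inc_mult X (\<phi> (galg_basis (hh g))) m) (\<psi> (galg_basis (kk g)))"
        "galg_basis (hh g) \<in> galg H" "galg_basis (kk g) \<in> galg K"
      using hk[of g] galg_basis_in_galg by (auto simp: b_def act_def)
    then show "v \<in> fun_vs.span
        {inc_mult X (inc_mult X (\<phi> a) m) (\<psi> b) | a b. a \<in> galg H \<and> b \<in> galg K}"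
      by (intro fun_vs.span_base) blast
  qed
  moreover have "b g \<in> A (d \<otimes> g) \<and> b g \<noteq> 0" if g: "g \<in> H <#> K" for g
  proof
    show "b g \<in> A (d \<otimes> g)"
      using act_homogeneous[of "hh g" "kk g" d m] hk[OF g] m unfolding b_def by auto
    obtain p where p: "m p \<noteq> 0" using m(4) by (auto simp: fun_eq_iff)
    then have "fst p \<in> diag_support e" "snd p \<in> diag_support f"
      using isotypicD[OF m(1)] by (auto simp: pairs_def)
    then have "weight \<phi> (fst p) (hh g) \<noteq> 0" "weight \<psi> (snd p) (kk g) \<noteq> 0"
      using hk[OF g] left.weight_inv[of "hh g" "fst p"] right.weight_inv[of "kk g" "snd p"] by auto
    then have "b g p \<noteq> 0" using p hk[OF g] inc by (simp add: b_def act_apply)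
    then show "b g \<noteq> 0" by auto
  qed
  moreover have "finite (H <#> K)" "H <#> K \<subseteq> carrier G"
    unfolding HK using left.finite_H right.finite_H by auto
  ultimately show ?thesis
    using graded_space_iso_homogeneous_basis[OF direct_sum _ _ m(3)] by blast
qed

text \<open>Each position in \<open>pairs\<close> has exactly one pair character, so the components
  split the block according to a partition of its positions.\<close>

lemma direct_sum_isotypic:
  assumes \<chi>: "bij_betw \<chi> I (pair_char ` pairs)"
  shows "is_direct_sum (peirce X r e f) I (\<lambda>l. isotypic (\<chi> l))"
  unfolding is_direct_sum_def
proof (intro conjI ballI)
  have finI: "finite I" using \<chi> finite_pairs by (simp add: bij_betw_finite)
  have inj: "inj_on \<chi> I" using \<chi> by (simp add: bij_betw_def)
  show "fun_vs.subspace (peirce X r e f)"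
    unfolding peirce_eq by (rule fun_vs.subspaceI) (auto, (metis add.left_neutral)+)
  show "fun_vs.subspace (isotypic (\<chi> l))" "isotypic (\<chi> l) \<subseteq> peirce X r e f" for l
    using subspace_isotypic isotypic_subset_peirce by auto
  fix w assume w: "w \<in> peirce X r e f"
  let ?Q = "\<lambda>u. (\<forall>l\<in>I. u l \<in> isotypic (\<chi> l)) \<and> (\<forall>l. l \<notin> I \<longrightarrow> u l = 0) \<and>
      finite {l. u l \<noteq> 0} \<and> w = (\<Sum>l | u l \<noteq> 0. u l)"
  \<comment> \<open>The component of index \<open>l\<close> is \<open>w\<close> truncated to the
    positions with character \<open>\<chi> l\<close>.\<close>
  define u0 where
    "u0 l = (\<lambda>p. if l \<in> I \<and> p \<in> pairs \<and> pair_char p = \<chi> l then w p else 0)" for l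
  have sum_eq: "(\<Sum>l | u l \<noteq> 0. u l) = (\<Sum>l\<in>I. u l)" if "\<forall>l. l \<notin> I \<longrightarrow> u l = 0"
    for u :: "_ \<Rightarrow> 'x \<times> 'x \<Rightarrow> 'f"
    by (rule sum.mono_neutral_left[OF finI]) (use that in auto)
  have fin: "finite {l. u l \<noteq> 0}" if "\<forall>l. l \<notin> I \<longrightarrow> u l = 0"
    for u :: "_ \<Rightarrow> 'x \<times> 'x \<Rightarrow> 'f"
    by (rule finite_subset[OF _ finI]) (use that in auto)
  \<comment> \<open>At a fixed position only one summand can be nonzero, because
    \<open>\<chi>\<close> is injective; this gives both existence and uniqueness.\<close>
  have component: "(\<Sum>k\<in>I. u k) p = u l p"
    if "\<forall>l\<in>I. u l \<in> isotypic (\<chi> l)" "l \<in> I" "pair_char p = \<chi> l" for u p l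
  proof -
    have "u k p = 0" if "k \<in> I" "k \<noteq> l" for k
      using that \<open>\<forall>l\<in>I. u l \<in> isotypic (\<chi> l)\<close> \<open>l \<in> I\<close> \<open>pair_char p = \<chi> l\<close> inj
        isotypicD[of "u k" "\<chi> k" p] by (auto simp: inj_on_def)
    then have "(\<Sum>k\<in>I. u k p) = (\<Sum>k\<in>{l}. u k p)"
      using \<open>l \<in> I\<close> finI by (intro sum.mono_neutral_right) auto
    then show ?thesis by (simp add: sum_apply)
  qed
  have u0_iso: "\<forall>l\<in>I. u0 l \<in> isotypic (\<chi> l)" by (auto simp: u0_def isotypic_def)
  have u0_zero: "\<forall>l. l \<notin> I \<longrightarrow> u0 l = 0" by (auto simp: u0_def fun_eq_iff)
  have "w p = (\<Sum>l\<in>I. u0 l) p" for p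
  proof (cases "p \<in> pairs")
    case True
    then obtain l where l: "l \<in> I" "pair_char p = \<chi> l"
      using \<chi> unfolding bij_betw_def by (metis imageE imageI)
    show ?thesis unfolding component[OF u0_iso l] using True l by (simp add: u0_def)
  next
    case False
    then have "w p = 0" using w unfolding peirce_eq by blast
    then show ?thesis using False by (simp add: sum_apply u0_def)
  qed
  then have u0_sum: "w = (\<Sum>l\<in>I. u0 l)" by blast
  show "\<exists>!u. ?Q u"
  proof (rule ex1I)
    show "?Q u0" unfolding sum_eq[OF u0_zero] using u0_iso u0_zero fin[OF u0_zero] u0_sum by blast
    fix u assume u: "?Q u"
    have u_sum: "w = (\<Sum>l\<in>I. u l)" using u sum_eq[of u] by argo
    show "u = u0"
    proof (intro ext)
      fix l p
      show "u l p = u0 l p"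
      proof (cases "l \<in> I \<and> p \<in> pairs \<and> pair_char p = \<chi> l")
        case True
        then show ?thesis using component[of u l p] u by (simp add: u0_def flip: u_sum)
      next
        case False
        have "u l p = 0"
          using False u isotypicD[of "u l" "\<chi> l" p] by (cases "l \<in> I") auto
        then show ?thesis using False by (auto simp: u0_def)
      qed
    qed
  qed
qed

end

section \<open>Assembly: one summand for each character that occurs in the block\<close>

theorem theorem2:
  fixes G :: "('g, 'b) monoid_scheme"
    and X :: "'x set" and r :: "'x rel"
    and A :: "'g \<Rightarrow> ('x \<times> 'x \<Rightarrow> 'f::field) set"
    and t :: nat and H :: "nat \<Rightarrow> 'g set"
    and e :: "nat \<Rightarrow> 'x \<times> 'x \<Rightarrow> 'f"
    and \<phi> :: "nat \<Rightarrow> ('g \<Rightarrow> 'f) \<Rightarrow> 'x \<times> 'x \<Rightarrow> 'f"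
    and i j :: nat
  assumes "comm_group G"
    and "finite X" and "partial_order_on X r"
    and "is_grading G (incidence_algebra r) (inc_mult X) A"
    and "block_triangular_form G X r A t H e \<phi>"
    and "1 \<le> i" and "i < j" and "j \<le> t"
  shows "\<exists>(s::nat) (\<chi> :: nat \<Rightarrow> 'g \<Rightarrow> 'f) (m :: nat \<Rightarrow> 'x \<times> 'x \<Rightarrow> 'f) (d :: nat \<Rightarrow> 'g).
     (\<forall>l\<in>{1..s}. \<chi> l \<in> characters G (H i \<inter> H j)) \<and>
     inj_on \<chi> {1..s} \<and>
     (\<forall>l\<in>{1..s}. m l \<in> peirce X r (e i) (e j) \<and> m l \<noteq> 0 \<and>
                  d l \<in> carrier G \<and> m l \<in> A (d l)) \<and>
     is_direct_sum (peirce X r (e i) (e j)) {1..s}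
       (\<lambda>l. cyclic_bimodule X (H i) (\<phi> i) (m l) (H j) (\<phi> j)) \<and>
     (\<forall>l\<in>{1..s}. \<forall>h\<in>H i \<inter> H j.
        inc_mult X (\<phi> i (galg_basis h)) (m l) =
        fscale (\<chi> l h) (inc_mult X (m l) (\<phi> j (galg_basis h)))) \<and>
     (\<forall>l\<in>{1..s}. \<exists>\<psi>. graded_space_iso G
        (cyclic_bimodule X (H i) (\<phi> i) (m l) (H j) (\<phi> j))
        (induced_grading A (cyclic_bimodule X (H i) (\<phi> i) (m l) (H j) (\<phi> j)))
        (galg (H i <#>\<^bsub>G\<^esub> H j))
        (shift_grading G (d l) (galg_grading (H i <#>\<^bsub>G\<^esub> H j)))
        \<psi>) \<and>
     s \<le> card (H i \<inter> H j)"
proof -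
  let ?B = "\<lambda>i. diagonal_block G X r A (H i) (e i) (\<phi> i)"
  have gia: "graded_incidence_algebra G X r A"
    using assms by (simp add: graded_incidence_algebra_def graded_incidence_algebra_axioms_def)
  have block: "?B k" if "k \<in> {1..t}" for k
  proof (intro diagonal_block.intro gia diagonal_block_axioms.intro)
    note form = assms(5)[unfolded block_triangular_form_def]
    show "subgroup (H k) G" "finite (H k)" "\<not> CHAR('f) dvd card (H k)"
      using form that by simp_all
    show "e k \<in> incidence_algebra r" "inc_mult X (e k) (e k) = e k"
      using form that by simp_all
    show "e k (x, y) = 0" if "x \<noteq> y" for x y
      using form \<open>k \<in> {1..t}\<close> that by simp
    show "graded_algebra_iso G (galg (H k)) (galg_mult G) (galg_grading (H k))
        (peirce X r (e k) (e k)) (inc_mult X) (induced_grading A (peirce X r (e k) (e k))) (\<phi> k)"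
      using form that by blast
  qed
  interpret block_pair G X r A "H i" "e i" "\<phi> i" "H j" "e j" "\<phi> j"
    unfolding block_pair_def using gia block[of i] block[of j] assms by simp
  \<comment> \<open>The witness for \<open>s\<close> is the number of occurring characters; a zero
    block has no pairs and gives \<open>s = 0\<close>.\<close>
  define C where "C = pair_char ` pairs"
  have finC: "finite C" using finite_pairs by (simp add: C_def)
  obtain \<chi> where \<chi>: "bij_betw \<chi> {1..card C} C"
    using finite_same_card_bij[of "{1..card C}" C] finC by auto
  have in_C: "\<exists>p\<in>pairs. pair_char p = \<chi> l" if "l \<in> {1..card C}" for l
    using bij_betwE[OF \<chi>] that unfolding C_def by (metis imageE)
  have "\<exists>m d. m \<in> isotypic (\<chi> l) \<and> m \<noteq> 0 \<and> d \<in> carrier G \<and> m \<in> A d"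
    if "l \<in> {1..card C}" for l
    using in_C[OF that] homogeneous_isotypic_exists by metis
  then obtain m d where md: "\<And>l. l \<in> {1..card C} \<Longrightarrow>
      m l \<in> isotypic (\<chi> l) \<and> m l \<noteq> 0 \<and> d l \<in> carrier G \<and> m l \<in> A (d l)"
    by metis
  \<comment> \<open>Any nonzero homogeneous element of an isotypic component has full support there,
    so it generates the component.\<close>
  have cyclic: "cyclic_bimodule X (H i) (\<phi> i) (m l) (H j) (\<phi> j) = isotypic (\<chi> l)"
    if "l \<in> {1..card C}" for l
    using md[OF that] by (intro cyclic_eq_isotypic homogeneous_isotypic_full_support) auto
  have "is_direct_sum (peirce X r (e i) (e j)) {1..card C} (\<lambda>l. isotypic (\<chi> l))"
    using \<chi> unfolding C_def by (rule direct_sum_isotypic)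
  then have "is_direct_sum (peirce X r (e i) (e j)) {1..card C}
      (\<lambda>l. cyclic_bimodule X (H i) (\<phi> i) (m l) (H j) (\<phi> j))"
    \<comment> \<open>Only the values on the index set enter \<open>is_direct_sum\<close>, so
      equality of the summands there is enough.\<close>
    unfolding is_direct_sum_def by (simp only: cyclic ball_triv simp_thms cong: ball_cong)
  moreover have "card C \<le> card (H i \<inter> H j)"
    using pair_char_in_characters left.finite_H finC
    by (intro card_characters_le subgroup_Int card_Int_neq_0) (auto simp: C_def)
  moreover have "\<chi> l \<in> characters G (H i \<inter> H j)" if "l \<in> {1..card C}" for l
    using in_C[OF that] pair_char_in_characters by metis
  moreover have "inj_on \<chi> {1..card C}" using \<chi> by (simp add: bij_betw_def)
  moreover have "m l \<in> peirce X r (e i) (e j)" if "l \<in> {1..card C}" for l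
    using md[OF that] isotypic_subset_peirce by blast
  moreover have "inc_mult X (\<phi> i (galg_basis h)) (m l) =
      fscale (\<chi> l h) (inc_mult X (m l) (\<phi> j (galg_basis h)))"
    if "l \<in> {1..card C}" "h \<in> H i \<inter> H j" for l h
    using md[OF that(1)] that(2) by (intro isotypic_left_right) auto
  moreover have "\<exists>\<psi>. graded_space_iso G
        (cyclic_bimodule X (H i) (\<phi> i) (m l) (H j) (\<phi> j))
        (induced_grading A (cyclic_bimodule X (H i) (\<phi> i) (m l) (H j) (\<phi> j)))
        (galg (H i <#>\<^bsub>G\<^esub> H j))
        (shift_grading G (d l) (galg_grading (H i <#>\<^bsub>G\<^esub> H j)))
        \<psi>" if "l \<in> {1..card C}" for l
    using md[OF that] by (intro cyclic_graded_iso) auto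
  ultimately show ?thesis
    using md by (intro exI[of _ "card C"] exI[of _ \<chi>] exI[of _ m] exI[of _ d]) blast
qed

end
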